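(* For all integers $n,f$ with $1\le f\le n-2$, $\mathrm{Cons}(n,f+1)$ is not $C$-reducible to $\mathrm{Cons}(n,f)$.
   Context: Model: a finite set of processes runs an asynchronous algorithm communicating by reliable message passing with unbounded delays and speeds; processes fail only by crashing. Time is $\mathcal T=\mathbb N$; a failure pattern $F$ for $\Pi$ is a nondecreasing map $\mathcal T\to2^\Pi$, $Faulty(F)=\bigcup_tF(t)$. A task $T=(P,f)$ consists of a binary agreement problem $P$ (mapping $(F,\vec V)$, $\vec V\in\{0,1\}^\Pi$, to a nonempty $P(F,\vec V)\subseteq\{0,1\}$) and a resiliency degree $f$. An algorithm solves $T$ if in every run with $|Faulty(F)|\le f$ and initial values $\vec V$: every correct process eventually decides, decisions are irrevocable, no two processes decide differently, and decisions lie in $P(F,\vec V)$. Binary Consensus $\mathrm{Cons}(n,f)=(\mathrm{Cons}_{\Pi},f)$ on $\Pi=\{1,\dots,n\}$: $\mathrm{Cons}_\Pi(F,\vec V)=\{v\}$ if all entries of $\vec V$ equal $v$, and $\{0,1\}$ otherwise. Oracles: for $T=(P,f)$ on $\Pi$, $\mathcal O.T$ is a black box with consultants $\Pi$; its history is a sequence of successive consultations, in each of which every consultant may submit at most one query in $\{0,1\}$ and the oracle returns a common response $d$ with $d\in P(F,\vec V)$ for every $\vec V$ extending the partial query vector (the oracle may use the whole failure pattern, including future crashes), and every correct querier gets the response whenever at least $|\Pi|-f$ consultants query; $\mathcal O.T$ is the most general such oracle. $T_1\le_C T_2$ means there is an algorithm solving $T_1$ whose processes, besides message passing, may consult (repeatedly,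 waiting for each answer) the oracle $\mathcal O.T_2$. *)

theory Defs
  imports Main
begin

text \<open>Processes are natural numbers; the process set is an explicit set Pi.
  Time is nat.  Binary values are bool (False = 0, True = 1).\<close>

type_synonym fpattern = "nat \<Rightarrow> nat set"

definition failure_pattern :: "nat set \<Rightarrow> fpattern \<Rightarrow> bool" where
  "failure_pattern Pi F \<longleftrightarrow> mono F \<and> (\<forall>t. F t \<subseteq> Pi)"

definition faulty :: "fpattern \<Rightarrow> nat set" where
  "faulty F = \<Union> (range F)"

definition correct :: "nat set \<Rightarrow> fpattern \<Rightarrow> nat set" where
  "correct Pi F = Pi - faulty F"

text \<open>A binary agreement problem maps a failure pattern and an initial-value
  vector to a set of admissible decision values; a task is a problem together
  with a resiliency degree.\<close>

type_synonym problem = "fpattern \<Rightarrow> (nat \<Rightarrow> bool) \<Rightarrow> bool set"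
type_synonym task = "problem \<times> nat"

definition cons_problem :: "nat set \<Rightarrow> problem" where
  "cons_problem Pi F V =
     (if \<exists>v. \<forall>p\<in>Pi. V p = v then {v. \<forall>p\<in>Pi. V p = v} else UNIV)"

definition Cons_task :: "nat \<Rightarrow> nat \<Rightarrow> task" where
  "Cons_task n f = (cons_problem {1..n}, f)"

datatype 'm inp = NullIn | MsgIn nat 'm | RespIn bool

definition is_msg :: "'m inp \<Rightarrow> bool" where
  "is_msg i = (case i of MsgIn _ _ \<Rightarrow> True | _ \<Rightarrow> False)"

definition is_resp :: "'m inp \<Rightarrow> bool" where
  "is_resp i = (case i of RespIn _ \<Rightarrow> True | _ \<Rightarrow> False)"

text \<open>An algorithm: for each process an initial state (depending on its initial
  value), a deterministic transition function (new state, list of messages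
  (destination, content) to send, optional oracle query), and a decision
  read off the local state.\<close>

record ('s, 'm) algorithm =
  a_init  :: "nat \<Rightarrow> bool \<Rightarrow> 's"
  a_trans :: "nat \<Rightarrow> 's \<Rightarrow> 'm inp \<Rightarrow> 's \<times> (nat \<times> 'm) list \<times> bool option"
  a_dec   :: "nat \<Rightarrow> 's \<Rightarrow> bool option"

text \<open>A (candidate) run: which process steps at each time (if any), the input of
  that step, for message receipts the sending event (time, index in the send
  list), and the common response of each oracle consultation.\<close>

record 'm schedule =
  sched :: "nat \<Rightarrow> nat option"
  input :: "nat \<Rightarrow> 'm inp"
  src   :: "nat \<Rightarrow> nat \<times> nat"
  resp  :: "nat \<Rightarrow> bool"

fun cfg :: "('s, 'm) algorithm \<Rightarrow> (nat \<Rightarrow> bool) \<Rightarrow> 'm schedule \<Rightarrow> nat \<Rightarrow> nat \<Rightarrow> 's" where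
  "cfg A V r 0 = (\<lambda>p. a_init A p (V p))"
| "cfg A V r (Suc t) =
     (case sched r t of
        None \<Rightarrow> cfg A V r t
      | Some p \<Rightarrow> (cfg A V r t)(p := fst (a_trans A p (cfg A V r t p) (input r t))))"

definition sends :: "('s, 'm) algorithm \<Rightarrow> (nat \<Rightarrow> bool) \<Rightarrow> 'm schedule \<Rightarrow> nat \<Rightarrow> (nat \<times> 'm) list" where
  "sends A V r t = (case sched r t of None \<Rightarrow> []
      | Some p \<Rightarrow> fst (snd (a_trans A p (cfg A V r t p) (input r t))))"

definition qout :: "('s, 'm) algorithm \<Rightarrow> (nat \<Rightarrow> bool) \<Rightarrow> 'm schedule \<Rightarrow> nat \<Rightarrow> bool option" where
  "qout A V r t = (case sched r t of None \<Rightarrow> None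
      | Some p \<Rightarrow> snd (snd (a_trans A p (cfg A V r t p) (input r t))))"

text \<open>Number of oracle queries issued / responses received by p before time t.
  The k-th query (counting from 0) of a process belongs to consultation k.\<close>

definition nq :: "('s, 'm) algorithm \<Rightarrow> (nat \<Rightarrow> bool) \<Rightarrow> 'm schedule \<Rightarrow> nat \<Rightarrow> nat \<Rightarrow> nat" where
  "nq A V r t p = card {t'. t' < t \<and> sched r t' = Some p \<and> qout A V r t' \<noteq> None}"

definition nr :: "'m schedule \<Rightarrow> nat \<Rightarrow> nat \<Rightarrow> nat" where
  "nr r t p = card {t'. t' < t \<and> sched r t' = Some p \<and> is_resp (input r t')}"

definition waiting :: "('s, 'm) algorithm \<Rightarrow> (nat \<Rightarrow> bool) \<Rightarrow> 'm schedule \<Rightarrow> nat \<Rightarrow> nat \<Rightarrow> bool" where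
  "waiting A V r t p \<longleftrightarrow> nr r t p < nq A V r t p"

definition blocked :: "('s, 'm) algorithm \<Rightarrow> (nat \<Rightarrow> bool) \<Rightarrow> 'm schedule \<Rightarrow> nat \<Rightarrow> bool" where
  "blocked A V r p \<longleftrightarrow> (\<exists>t0. \<forall>t\<ge>t0. sched r t \<noteq> Some p \<and> waiting A V r t p)"

definition queried :: "('s, 'm) algorithm \<Rightarrow> (nat \<Rightarrow> bool) \<Rightarrow> 'm schedule \<Rightarrow> nat \<Rightarrow> nat \<Rightarrow> nat \<Rightarrow> bool \<Rightarrow> bool" where
  "queried A V r T k p b \<longleftrightarrow>
     (\<exists>t<T. sched r t = Some p \<and> nq A V r t p = k \<and> qout A V r t = Some b)"

definition queried_ever :: "('s, 'm) algorithm \<Rightarrow> (nat \<Rightarrow> bool) \<Rightarrow> 'm schedule \<Rightarrow> nat \<Rightarrow> nat \<Rightarrow> bool" where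
  "queried_ever A V r k p \<longleftrightarrow>
     (\<exists>t b. sched r t = Some p \<and> nq A V r t p = k \<and> qout A V r t = Some b)"

text \<open>Admissible runs of A on process set Pi, with failure pattern F, initial
  values V, and access to the most general oracle O.(P2, f2) with consultants Pi.\<close>

definition is_run :: "('s, 'm) algorithm \<Rightarrow> nat set \<Rightarrow> fpattern \<Rightarrow> (nat \<Rightarrow> bool)
    \<Rightarrow> problem \<Rightarrow> nat \<Rightarrow> 'm schedule \<Rightarrow> bool" where
  "is_run A Pi F V P2 f2 r \<longleftrightarrow>
     \<comment> \<open>only alive processes of Pi take steps\<close>
     (\<forall>t p. sched r t = Some p \<longrightarrow> p \<in> Pi \<and> p \<notin> F t)
     \<comment> \<open>a waiting process can only receive the response of its pending
         consultation; otherwise a step is a null step or receives a message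
         previously sent to it\<close>
   \<and> (\<forall>t p. sched r t = Some p \<longrightarrow>
        (if waiting A V r t p then input r t = RespIn (resp r (nr r t p))
         else input r t = NullIn \<or>
           (\<exists>q m. input r t = MsgIn q m \<and> fst (src r t) < t
              \<and> sched r (fst (src r t)) = Some q
              \<and> snd (src r t) < length (sends A V r (fst (src r t)))
              \<and> sends A V r (fst (src r t)) ! snd (src r t) = (p, m))))
     \<comment> \<open>no message is received twice\<close>
   \<and> (\<forall>t t'. sched r t \<noteq> None \<and> sched r t' \<noteq> None \<and> is_msg (input r t)
        \<and> is_msg (input r t') \<and> src r t = src r t' \<longrightarrow> t = t')
     \<comment> \<open>reliable channels: messages to correct processes are received\<close>
   \<and> (\<forall>t i p m. i < length (sends A V r t) \<and> sends A V r t ! i = (p, m)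
        \<and> p \<in> correct Pi F \<longrightarrow>
        (\<exists>t'. sched r t' = Some p \<and> is_msg (input r t') \<and> src r t' = (t, i))
        \<or> blocked A V r p)
     \<comment> \<open>correct processes take infinitely many steps unless blocked on the oracle\<close>
   \<and> (\<forall>p\<in>correct Pi F. (\<forall>t. \<exists>t'\<ge>t. sched r t' = Some p) \<or> blocked A V r p)
     \<comment> \<open>oracle safety: the common response of consultation k is admissible for
         every vector extending the queries of consultation k submitted so far\<close>
   \<and> (\<forall>t p. sched r t = Some p \<and> is_resp (input r t) \<longrightarrow>
        (\<forall>W. (\<forall>q b. queried A V r t (nr r t p) q b \<longrightarrow> W q = b)
             \<longrightarrow> resp r (nr r t p) \<in> P2 F W))
     \<comment> \<open>oracle liveness: if at least |Pi| - f2 consultants query in consultation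
         k, every correct querier gets the response\<close>
   \<and> (\<forall>p k. p \<in> correct Pi F \<and> queried_ever A V r k p
        \<and> card {q\<in>Pi. queried_ever A V r k q} \<ge> card Pi - f2 \<longrightarrow>
        (\<exists>t. sched r t = Some p \<and> is_resp (input r t) \<and> nr r t p = k))"

definition solves_with :: "('s, 'm) algorithm \<Rightarrow> nat set \<Rightarrow> task \<Rightarrow> task \<Rightarrow> bool" where
  "solves_with A Pi T1 T2 \<longleftrightarrow>
     (\<forall>F V r. failure_pattern Pi F \<and> card (faulty F) \<le> snd T1
        \<and> is_run A Pi F V (fst T2) (snd T2) r \<longrightarrow>
        (\<forall>p\<in>correct Pi F. \<exists>t d. a_dec A p (cfg A V r t p) = Some d)
      \<and> (\<forall>p\<in>Pi. \<forall>t t' d. t \<le> t' \<and> a_dec A p (cfg A V r t p) = Some d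
            \<longrightarrow> a_dec A p (cfg A V r t' p) = Some d)
      \<and> (\<forall>p\<in>Pi. \<forall>q\<in>Pi. \<forall>t t' d d'. a_dec A p (cfg A V r t p) = Some d
            \<and> a_dec A q (cfg A V r t' q) = Some d' \<longrightarrow> d = d')
      \<and> (\<forall>p\<in>Pi. \<forall>t d. a_dec A p (cfg A V r t p) = Some d \<longrightarrow> d \<in> fst T1 F V))"

end

theory Submission
  imports Defs
begin

text \<open>If \<open>f + 1\<close> processes crash before submitting a query, a consultation receives at most
  \<open>n - f - 1\<close> queries and need not be answered. Hence a process that is the first to query must already
  have decided, as it may be blocked for ever: before the first decision no process consults the oracle.
  On query-free prefixes a bivalence argument applies. Since \<open>f + 1 \<ge> 2\<close>, the two processes whose steps
  distinguish neighbouring configurations of opposite valency can both be crashed, and the decision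
  that the others reach without the oracle is compatible with both configurations.\<close>

section \<open>Prefixes of schedules\<close>

text \<open>No step commutation is needed. Whatever two processes do in two consecutive slots, even
  if they receive different messages or are one and the same process, the others cannot notice it
  once both crash and their last messages are delayed. A second permitted crash thus replaces the
  usual diamond argument. The difficulty is that successors of a query-free prefix may themselves
  contain queries, possibly by processes that are to crash, and must still extend to admissible runs
  for their valency to make sense. Answering consultation 0 with a value already submitted achieves
  this: such a value is admissible for every completion of the query vector. Later consultations
  stay silent, since the crashed processes never reach them. The survivors' continuation is used
  only up to their first decision, because afterwards they may query. The bound
  \<open>f + 2 \<le> n\<close> leaves a survivor after \<open>f + 1\<close> crashes, and lets the
  crashed set avoid any given process.\<close>

definition agree :: "'m schedule \<Rightarrow> 'm schedule \<Rightarrow> nat \<Rightarrow> bool" where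
  "agree r r' t \<longleftrightarrow>
     (\<forall>s<t. sched r s = sched r' s \<and> input r s = input r' s \<and> src r s = src r' s)"

definition upd :: "'m schedule \<Rightarrow> nat \<Rightarrow> nat option \<Rightarrow> 'm inp \<Rightarrow> nat \<times> nat \<Rightarrow> 'm schedule" where
  "upd r t a i x = r\<lparr>sched := (sched r)(t := a), input := (input r)(t := i), src := (src r)(t := x)\<rparr>"

lemma upd_simps [simp]:
  "sched (upd r t a i x) = (sched r)(t := a)"
  "input (upd r t a i x) = (input r)(t := i)"
  "src (upd r t a i x) = (src r)(t := x)"
  by (simp_all add: upd_def)

lemma is_msg_simps [simp]: "\<not> is_msg NullIn" "is_msg (MsgIn q m)" "\<not> is_msg (RespIn b)"
  by (simp_all add: is_msg_def)

lemma is_resp_simps [simp]: "\<not> is_resp NullIn" "\<not> is_resp (MsgIn q m)" "is_resp (RespIn b)"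
  by (simp_all add: is_resp_def)

lemma agree_refl [simp]: "agree r r t"
  by (simp add: agree_def)

lemma agree_sym: "agree r r' t \<Longrightarrow> agree r' r t"
  by (simp add: agree_def)

lemma agree_trans: "agree r r' t \<Longrightarrow> agree r' r'' t \<Longrightarrow> agree r r'' t"
  by (simp add: agree_def)

lemma agree_mono: "agree r r' t \<Longrightarrow> s \<le> t \<Longrightarrow> agree r r' s"
  by (simp add: agree_def)

lemma agree_upd [simp]: "agree r (upd r t a i x) t"
  by (simp add: agree_def)

lemma agreeD:
  assumes "agree r r' t" "s < t"
  shows "sched r s = sched r' s" "input r s = input r' s" "src r s = src r' s"
  using assms by (simp_all add: agree_def)

lemma cfg_agree: "agree r r' t \<Longrightarrow> s \<le> t \<Longrightarrow> cfg A V r s = cfg A V r' s"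
proof (induction s)
  case (Suc s)
  then show ?case by (auto simp: agreeD[of r r' t s] fun_eq_iff split: option.split)
qed simp

lemma sends_agree: "agree r r' t \<Longrightarrow> s < t \<Longrightarrow> sends A V r s = sends A V r' s"
  by (simp add: sends_def agreeD[of r r' t s] cfg_agree[of r r' t s] split: option.split)

lemma qout_agree: "agree r r' t \<Longrightarrow> s < t \<Longrightarrow> qout A V r s = qout A V r' s"
  by (simp add: qout_def agreeD[of r r' t s] cfg_agree[of r r' t s] split: option.split)

lemma nq_agree: "agree r r' t \<Longrightarrow> s \<le> t \<Longrightarrow> nq A V r s p = nq A V r' s p"
  unfolding nq_def
  by (rule arg_cong[where f = card], intro Collect_cong)
     (metis agreeD(1) qout_agree order_less_le_trans)

lemma nr_agree: "agree r r' t \<Longrightarrow> s \<le> t \<Longrightarrow> nr r s p = nr r' s p"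
  unfolding nr_def
  by (rule arg_cong[where f = card], intro Collect_cong)
     (metis agreeD(1,2) order_less_le_trans)

lemma waiting_agree: "agree r r' t \<Longrightarrow> s \<le> t \<Longrightarrow> waiting A V r s p = waiting A V r' s p"
  by (simp add: waiting_def nq_agree[of r r' t] nr_agree[of r r' t])

lemma cfg_idle:
  assumes "\<And>u. s \<le> u \<Longrightarrow> u < t \<Longrightarrow> sched r u \<noteq> Some p" "s \<le> t"
  shows "cfg A V r t p = cfg A V r s p"
  using assms(2,1)
proof (induction t rule: dec_induct)
  case (step t)
  then have "sched r t \<noteq> Some p" by simp
  with step show ?case by (auto split: option.split)
qed simp

lemma nq_pos: "sched r s = Some p \<Longrightarrow> qout A V r s \<noteq> None \<Longrightarrow> s < t \<Longrightarrow> 0 < nq A V r t p"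
  unfolding nq_def by (subst card_gt_0_iff) auto

lemma nr_pos: "sched r s = Some p \<Longrightarrow> is_resp (input r s) \<Longrightarrow> s < t \<Longrightarrow> 0 < nr r t p"
  unfolding nr_def by (subst card_gt_0_iff) auto

lemma nq_eq_0_iff:
  "nq A V r t p = 0 \<longleftrightarrow> (\<forall>s<t. sched r s = Some p \<longrightarrow> qout A V r s = None)"
  unfolding nq_def by (subst card_eq_0_iff) auto

lemma nr_eq_0_iff:
  "nr r t p = 0 \<longleftrightarrow> (\<forall>s<t. sched r s = Some p \<longrightarrow> \<not> is_resp (input r s))"
  unfolding nr_def by (subst card_eq_0_iff) auto

lemma nq_idle: "sched r t \<noteq> Some p \<Longrightarrow> nq A V r (Suc t) p = nq A V r t p"
  unfolding nq_def by (auto intro!: arg_cong[where f = card] simp: less_Suc_eq)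

lemma nr_idle: "sched r t \<noteq> Some p \<Longrightarrow> nr r (Suc t) p = nr r t p"
  unfolding nr_def by (auto intro!: arg_cong[where f = card] simp: less_Suc_eq)

lemma waiting_idle: "sched r t \<noteq> Some p \<Longrightarrow> waiting A V r (Suc t) p = waiting A V r t p"
  by (simp add: waiting_def nq_idle nr_idle)

lemma not_waiting_if_no_query: "nq A V r t p = 0 \<Longrightarrow> \<not> waiting A V r t p"
  by (simp add: waiting_def)

lemma qout_None_idle: "sched r t = None \<Longrightarrow> qout A V r t = None"
  by (simp add: qout_def)

lemma sends_idle: "sched r t = None \<Longrightarrow> sends A V r t = []"
  by (simp add: sends_def)

text \<open>Diagonal construction: slot \<open>s\<close> of the limit is read from stage
  \<open>Suc s\<close>. Strict growth of \<open>T\<close> gives \<open>s < T (Suc s)\<close>, so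
  this slot no longer changes at later stages.\<close>

lemma limit_schedule:
  assumes init: "P 0 r0 t0"
    and step: "\<And>j r t. P j r t \<Longrightarrow> \<exists>r' t'. t < t' \<and> agree r r' t \<and> P (Suc j) r' t'"
  shows "\<exists>r T. strict_mono T \<and> T 0 = t0 \<and> (\<forall>j. \<exists>r'. P j r' (T j) \<and> agree r' r (T j))"
proof -
  have "\<exists>g. \<forall>j. (P j (fst (g j)) (snd (g j)) \<and> (j = 0 \<longrightarrow> g j = (r0, t0))) \<and>
      (snd (g j) < snd (g (Suc j)) \<and> agree (fst (g j)) (fst (g (Suc j))) (snd (g j)))"
  proof (rule dependent_nat_choice)
    show "\<exists>x. P 0 (fst x) (snd x) \<and> ((0::nat) = 0 \<longrightarrow> x = (r0, t0))"
      using init by auto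
    fix x and j :: nat
    assume "P j (fst x) (snd x) \<and> (j = 0 \<longrightarrow> x = (r0, t0))"
    then obtain r' t' where "snd x < t'" "agree (fst x) r' (snd x)" "P (Suc j) r' t'"
      using step by blast
    then show "\<exists>y. (P (Suc j) (fst y) (snd y) \<and> (Suc j = 0 \<longrightarrow> y = (r0, t0))) \<and>
        (snd x < snd y \<and> agree (fst x) (fst y) (snd x))"
      by (intro exI[of _ "(r', t')"]) auto
  qed
  then obtain g where g: "\<And>j. P j (fst (g j)) (snd (g j))" "g 0 = (r0, t0)"
      "\<And>j. snd (g j) < snd (g (Suc j))" "\<And>j. agree (fst (g j)) (fst (g (Suc j))) (snd (g j))"
    by blast
  define T where "T = (\<lambda>j. snd (g j))"
  define R where "R = (\<lambda>j. fst (g j))"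
  have mono: "strict_mono T"
    using g(3) by (simp add: strict_mono_Suc_iff T_def)
  have "agree (R j) (R (j + k)) (T j)" for j k
  proof (induction k)
    case (Suc k)
    have "T j \<le> T (j + k)" using mono by (simp add: strict_mono_less_eq)
    then have "agree (R (j + k)) (R (Suc (j + k))) (T j)"
      using g(4) agree_mono unfolding R_def T_def by blast
    with Suc show ?case by (auto intro: agree_trans)
  qed simp
  then have RR: "agree (R j) (R k) (T j)" if "j \<le> k" for j k
    using that le_Suc_ex by blast
  define r where "r = r0\<lparr>sched := (\<lambda>s. sched (R (Suc s)) s), input := (\<lambda>s. input (R (Suc s)) s),
      src := (\<lambda>s. src (R (Suc s)) s)\<rparr>"
  have "agree (R j) r (T j)" for j
  proof -
    have "sched (R j) s = sched (R (Suc s)) s \<and> input (R j) s = input (R (Suc s)) s \<and>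
        src (R j) s = src (R (Suc s)) s" if s: "s < T j" for s
    proof (cases "j \<le> Suc s")
      case True
      then show ?thesis using RR s by (auto simp: agree_def)
    next
      case False
      have "s < T (Suc s)" using strict_mono_imp_increasing[OF mono, of "Suc s"] by simp
      then show ?thesis using RR[of "Suc s" j] False by (auto simp: agree_def)
    qed
    then show ?thesis by (simp add: agree_def r_def)
  qed
  then show ?thesis
    using g mono by (intro exI[of _ r] exI[of _ T]) (auto simp: T_def R_def)
qed

section \<open>Legal prefixes and fair steps\<close>

definition msg_ok :: "('s, 'm) algorithm \<Rightarrow> (nat \<Rightarrow> bool) \<Rightarrow> 'm schedule \<Rightarrow> nat \<Rightarrow> nat \<Rightarrow> bool" where
  "msg_ok A V r t p \<longleftrightarrow> (\<exists>q m. input r t = MsgIn q m \<and> fst (src r t) < t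
      \<and> sched r (fst (src r t)) = Some q
      \<and> snd (src r t) < length (sends A V r (fst (src r t)))
      \<and> sends A V r (fst (src r t)) ! snd (src r t) = (p, m))"

text \<open>Failure pattern and oracle are absent on purpose, so that crashes and answers can be
  chosen after the prefix. Queries may occur, but their authors then stop within the prefix; hence
  no response occurs in it.\<close>

definition legal :: "('s, 'm) algorithm \<Rightarrow> nat set \<Rightarrow> (nat \<Rightarrow> bool) \<Rightarrow> 'm schedule \<Rightarrow> nat \<Rightarrow> bool" where
  "legal A Pi V r t \<longleftrightarrow>
     (\<forall>s<t. \<forall>p. sched r s = Some p \<longrightarrow>
        p \<in> Pi \<and> \<not> waiting A V r s p \<and> (input r s = NullIn \<or> msg_ok A V r s p))
   \<and> (\<forall>s<t. \<forall>s'<t. sched r s \<noteq> None \<and> sched r s' \<noteq> None \<and> is_msg (input r s)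
        \<and> is_msg (input r s') \<and> src r s = src r s' \<longrightarrow> s = s')"

definition pending :: "('s, 'm) algorithm \<Rightarrow> (nat \<Rightarrow> bool) \<Rightarrow> 'm schedule \<Rightarrow> nat \<Rightarrow> nat \<Rightarrow> (nat \<times> nat) set" where
  "pending A V r t p = {(s, i). s < t \<and> i < length (sends A V r s) \<and> fst (sends A V r s ! i) = p
      \<and> \<not> (\<exists>s'<t. sched r s' = Some p \<and> is_msg (input r s') \<and> src r s' = (s, i))}"

text \<open>Oldest-first delivery. Only sending times are compared; messages sent in the same step
  may be taken in any order.\<close>

definition fair_step :: "('s, 'm) algorithm \<Rightarrow> (nat \<Rightarrow> bool) \<Rightarrow> 'm schedule \<Rightarrow> nat \<Rightarrow> nat \<Rightarrow> bool" where
  "fair_step A V r t p \<longleftrightarrow> sched r t = Some p \<and> \<not> waiting A V r t p \<and>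
     (if pending A V r t p = {} then input r t = NullIn
      else msg_ok A V r t p \<and> src r t \<in> pending A V r t p
         \<and> (\<forall>x\<in>pending A V r t p. fst (src r t) \<le> fst x))"

lemma msg_ok_agree:
  assumes "agree r r' (Suc t)" "msg_ok A V r t p"
  shows "msg_ok A V r' t p"
  using assms(2) unfolding msg_ok_def
  by (metis agreeD[OF assms(1)] sends_agree[OF assms(1)] lessI less_Suc_eq)

lemma msg_ok_is_msg: "msg_ok A V r t p \<Longrightarrow> is_msg (input r t)"
  by (auto simp: msg_ok_def is_msg_def)

lemma legal_agree:
  assumes "agree r r' t" "legal A Pi V r t"
  shows "legal A Pi V r' t"
proof -
  have "msg_ok A V r s p \<Longrightarrow> msg_ok A V r' s p" if "s < t" for s p
    using msg_ok_agree agree_mono[OF assms(1)] that Suc_leI by blast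
  moreover have "waiting A V r s p = waiting A V r' s p" if "s < t" for s p
    using waiting_agree[OF assms(1)] that by (meson less_imp_le)
  ultimately show ?thesis
    using assms(2) agreeD[OF assms(1)] unfolding legal_def by (metis (no_types, lifting))
qed

lemma legal_mono: "legal A Pi V r t \<Longrightarrow> s \<le> t \<Longrightarrow> legal A Pi V r s"
  unfolding legal_def by (meson order.strict_trans2)

lemma pending_agree:
  assumes "agree r r' t"
  shows "pending A V r t p = pending A V r' t p"
  unfolding pending_def using agreeD[OF assms] sends_agree[OF assms, of _ A V] by auto

lemma fair_step_agree:
  assumes "agree r r' (Suc t)" "fair_step A V r t p"
  shows "fair_step A V r' t p"
proof -
  have "agree r r' t" using assms(1) agree_mono le_SucI by blast
  then show ?thesis
    using assms(2) pending_agree[of r r' t A V p] waiting_agree[of r r' t t A V p]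
      msg_ok_agree[OF assms(1)] agreeD[OF assms(1), of t]
    by (auto simp: fair_step_def split: if_splits)
qed

lemma fair_step_exists:
  assumes "\<not> waiting A V r t p"
  shows "\<exists>i x. fair_step A V (upd r t (Some p) i x) t p"
proof (cases "pending A V r t p = {}")
  case True
  have "pending A V (upd r t (Some p) NullIn (0,0)) t p = {}"
    using pending_agree[OF agree_upd] True by metis
  moreover have "\<not> waiting A V (upd r t (Some p) NullIn (0,0)) t p"
    using waiting_agree[OF agree_upd] assms by blast
  ultimately show ?thesis
    by (intro exI[of _ NullIn] exI[of _ "(0,0)"]) (simp add: fair_step_def)
next
  case False
  then obtain x where x: "x \<in> pending A V r t p" "\<forall>y\<in>pending A V r t p. fst x \<le> fst y"
    using ex_has_least_nat[of "\<lambda>x. x \<in> pending A V r t p" _ fst] by (metis ex_in_conv)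
  obtain s i where si: "x = (s, i)" by fastforce
  with x have s: "s < t" "i < length (sends A V r s)" "fst (sends A V r s ! i) = p"
    by (auto simp: pending_def)
  then obtain q where q: "sched r s = Some q"
    by (cases "sched r s") (auto simp: sends_idle)
  define r' where "r' = upd r t (Some p) (MsgIn q (snd (sends A V r s ! i))) x"
  have a: "agree r r' t" by (simp add: r'_def)
  have "msg_ok A V r' t p"
    unfolding msg_ok_def
  proof (intro exI conjI)
    have x': "src r' t = x" by (simp add: r'_def)
    show "input r' t = MsgIn q (snd (sends A V r s ! i))" by (simp add: r'_def)
    show "fst (src r' t) < t" using s si x' by simp
    show "sched r' (fst (src r' t)) = Some q" using s si q x' agreeD[OF a s(1)] by simp
    have "sends A V r' s = sends A V r s" using sends_agree[OF a s(1)] by metis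
    then show "snd (src r' t) < length (sends A V r' (fst (src r' t)))"
      "sends A V r' (fst (src r' t)) ! snd (src r' t) = (p, snd (sends A V r s ! i))"
      using s si x' by (auto simp: prod_eq_iff)
  qed
  moreover have "\<not> waiting A V r' t p"
    using waiting_agree[OF a] assms by blast
  moreover have "pending A V r' t p = pending A V r t p"
    using pending_agree[OF a] by metis
  ultimately have "fair_step A V r' t p"
    unfolding fair_step_def using x False by (simp add: r'_def)
  then show ?thesis unfolding r'_def by blast
qed

lemma pending_not_received:
  "src r t \<in> pending A V r t p \<Longrightarrow> s < t \<Longrightarrow> sched r s = Some p \<Longrightarrow> is_msg (input r s) \<Longrightarrow>
    src r s \<noteq> src r t"
  by (auto simp: pending_def)

lemma fair_step_ok:
  assumes "fair_step A V r t p"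
  shows "sched r t = Some p" "\<not> waiting A V r t p" "input r t = NullIn \<or> msg_ok A V r t p"
  using assms by (auto simp: fair_step_def split: if_splits)

lemma msg_ok_same_src:
  assumes "msg_ok A V r s p" "msg_ok A V r t q" "src r s = src r t"
  shows "p = q"
  using assms by (auto simp: msg_ok_def)

text \<open>A message identifier determines its addressee, so an earlier reception of the same
  message would be by \<open>p\<close> itself, and the message would no longer be pending.\<close>

lemma fair_step_new_src:
  assumes "fair_step A V r t p" "is_msg (input r t)" "msg_ok A V r s q" "s < t" "sched r s = Some q"
  shows "src r s \<noteq> src r t"
proof
  assume eq: "src r s = src r t"
  have ne: "pending A V r t p \<noteq> {}" using assms(1,2) by (auto simp: fair_step_def is_msg_def)
  then have t: "msg_ok A V r t p" "src r t \<in> pending A V r t p"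
    using assms(1) unfolding fair_step_def by metis+
  have "q = p" using msg_ok_same_src[OF assms(3) t(1) eq] .
  then show False
    using pending_not_received[OF t(2) assms(4)] assms(5) eq msg_ok_is_msg[OF assms(3)] by blast
qed

lemma legal_fair_step:
  assumes "legal A Pi V r t" "fair_step A V r t p" "p \<in> Pi"
  shows "legal A Pi V r (Suc t)"
proof -
  have new: "src r s \<noteq> src r t" 
    if h: "s < t" "sched r s \<noteq> None" "is_msg (input r s)" "is_msg (input r t)" for s
  proof -
    obtain q where q: "sched r s = Some q" using h(2) by blast
    then have "msg_ok A V r s q" using assms(1) h unfolding legal_def by (metis is_msg_simps(1))
    then show ?thesis using fair_step_new_src[OF assms(2)] h q by blast
  qed
  show ?thesis
    unfolding legal_def
  proof (intro conjI allI impI)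
    fix s s'
    assume "s < Suc t" "s' < Suc t" and h: "sched r s \<noteq> None \<and> sched r s' \<noteq> None \<and>
      is_msg (input r s) \<and> is_msg (input r s') \<and> src r s = src r s'"
    then consider "s < t" "s' < t" | "s = t" "s' < t" | "s < t" "s' = t" | "s = t" "s' = t"
      by linarith
    then show "s = s'"
    proof cases
      case 1
      then show ?thesis using h assms(1) unfolding legal_def by blast
    qed (use h new in metis)+
  next
    fix s q
    assume "s < Suc t" "sched r s = Some q"
    then show "q \<in> Pi" "\<not> waiting A V r s q" "input r s = NullIn \<or> msg_ok A V r s q"
      using assms(1,3) fair_step_ok[OF assms(2)] unfolding legal_def less_Suc_eq
      by (metis option.inject)+
  qed
qed

lemma legal_idle:
  assumes "legal A Pi V r t" "sched r t = None"
  shows "legal A Pi V r (Suc t)"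
  using assms unfolding legal_def less_Suc_eq by (metis option.distinct(1))

lemma legal_nr: "legal A Pi V r t \<Longrightarrow> s \<le> t \<Longrightarrow> nr r s p = 0"
  unfolding nr_eq_0_iff legal_def msg_ok_def
  by (metis is_resp_simps(1,2) order.strict_trans2)

text \<open>While a message sent at time \<open>t\<close> stays pending, each fair step of
  \<open>p\<close> after \<open>t\<close> consumes a different message sent at time at most
  \<open>t\<close>, and there are only finitely many of those.\<close>

lemma fair_delivery:
  assumes inf: "\<And>T. \<exists>s\<ge>T. fair_step A V r s p"
    and msg: "i < length (sends A V r t)" "sends A V r t ! i = (p, m)"
  shows "\<exists>t'. sched r t' = Some p \<and> is_msg (input r t') \<and> src r t' = (t, i)"
proof (rule ccontr)
  assume none: "\<not> ?thesis"
  define S where "S = {s. t < s \<and> fair_step A V r s p}"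
  have pend: "(t, i) \<in> pending A V r s p" if "t < s" for s
    using that msg none by (auto simp: pending_def)
  have S: "sched r s = Some p" "is_msg (input r s)" "src r s \<in> pending A V r s p" "fst (src r s) \<le> t"
    if "s \<in> S" for s
    using that pend[of s] msg_ok_is_msg[of A V r s p]
    by (fastforce simp: S_def fair_step_def split: if_splits)+
  have "infinite S"
  proof
    assume "finite S"
    then obtain k where k: "\<forall>s\<in>S. s \<le> k" by (auto simp: finite_nat_set_iff_bounded_le)
    obtain s where "s \<ge> Suc (max t k)" "fair_step A V r s p" using inf by blast
    then have "s \<in> S" "\<not> s \<le> k" by (auto simp: S_def)
    with k show False by blast
  qed
  moreover have "inj_on src' S" if "src' = src r" for src'
  proof (rule linorder_inj_onI)
    fix x y assume "x < y" "x \<in> S" "y \<in> S"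
    then show "src' x \<noteq> src' y"
      using S pending_not_received that by metis
  qed auto
  moreover have "src r ` S \<subseteq> Sigma {..t} (\<lambda>s. {..<length (sends A V r s)})"
  proof
    fix x assume "x \<in> src r ` S"
    then obtain s where "s \<in> S" "x = src r s" by blast
    then show "x \<in> Sigma {..t} (\<lambda>s. {..<length (sends A V r s)})"
      using S(3,4)[of s] by (cases x) (auto simp: pending_def)
  qed
  ultimately show False
    by (meson finite_SigmaI finite_atMost finite_lessThan finite_imageD finite_subset)
qed

section \<open>Extending a legal prefix by crashing processes\<close>

lemma is_run_iff:
  "is_run A Pi F V P2 f2 r \<longleftrightarrow>
     (\<forall>t p. sched r t = Some p \<longrightarrow> p \<in> Pi \<and> p \<notin> F t)
   \<and> (\<forall>t p. sched r t = Some p \<longrightarrow>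
        (if waiting A V r t p then input r t = RespIn (resp r (nr r t p))
         else input r t = NullIn \<or> msg_ok A V r t p))
   \<and> (\<forall>t t'. sched r t \<noteq> None \<and> sched r t' \<noteq> None \<and> is_msg (input r t)
        \<and> is_msg (input r t') \<and> src r t = src r t' \<longrightarrow> t = t')
   \<and> (\<forall>t i p m. i < length (sends A V r t) \<and> sends A V r t ! i = (p, m)
        \<and> p \<in> correct Pi F \<longrightarrow>
        (\<exists>t'. sched r t' = Some p \<and> is_msg (input r t') \<and> src r t' = (t, i))
        \<or> blocked A V r p)
   \<and> (\<forall>p\<in>correct Pi F. (\<forall>t. \<exists>t'\<ge>t. sched r t' = Some p) \<or> blocked A V r p)
   \<and> (\<forall>t p. sched r t = Some p \<and> is_resp (input r t) \<longrightarrow>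
        (\<forall>W. (\<forall>q b. queried A V r t (nr r t p) q b \<longrightarrow> W q = b)
             \<longrightarrow> resp r (nr r t p) \<in> P2 F W))
   \<and> (\<forall>p k. p \<in> correct Pi F \<and> queried_ever A V r k p
        \<and> card {q\<in>Pi. queried_ever A V r k q} \<ge> card Pi - f2 \<longrightarrow>
        (\<exists>t. sched r t = Some p \<and> is_resp (input r t) \<and> nr r t p = k))"
  unfolding is_run_def msg_ok_def ..

text \<open>Stability says that \<open>Q\<close> at slot \<open>s\<close> looks only at slots up to
  \<open>s\<close>; choices made slot by slot therefore survive in the limit.\<close>

lemma extend_schedule:
  assumes ex: "\<And>r s. \<exists>a i x. Q (upd r s a i x) s"
    and stable: "\<And>r r' s. agree r r' (Suc s) \<Longrightarrow> Q r s \<Longrightarrow> Q r' s"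
  shows "\<exists>r'. agree r r' t \<and> (\<forall>s\<ge>t. Q r' s)"
proof -
  define P where "P = (\<lambda>j r' s. s = t + j \<and> agree r r' t \<and> (\<forall>u. t \<le> u \<and> u < s \<longrightarrow> Q r' u))"
  have "\<exists>r' s'. s < s' \<and> agree r1 r' s \<and> P (Suc j) r' s'" if P: "P j r1 s" for j r1 s
  proof -
    obtain a i x where Q: "Q (upd r1 s a i x) s" using ex by blast
    have a: "agree r1 (upd r1 s a i x) s" by simp
    have "Q (upd r1 s a i x) u" if "t \<le> u" "u < Suc s" for u
    proof (cases "u = s")
      case False
      then have "u < s" using that by simp
      then have "agree r1 (upd r1 s a i x) (Suc u)" using a agree_mono Suc_leI by blast
      moreover have "Q r1 u" using P \<open>u < s\<close> that unfolding P_def by blast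
      ultimately show ?thesis using stable by blast
    qed (use Q in simp)
    moreover have "agree r (upd r1 s a i x) t"
      using P a agree_trans agree_mono unfolding P_def by (metis le_add1)
    ultimately show ?thesis
      using P a unfolding P_def by (intro exI[of _ "upd r1 s a i x"] exI[of _ "Suc s"]) auto
  qed
  moreover have "P 0 r t" unfolding P_def by auto
  ultimately obtain r' T where T: "\<And>j. \<exists>r1. P j r1 (T j) \<and> agree r1 r' (T j)"
    using limit_schedule[of P r t] by blast
  have "agree r r' t"
    using T[of 0] agree_trans unfolding P_def by (metis add_0_right)
  moreover have "Q r' s" if "s \<ge> t" for s
  proof -
    obtain r1 where "P (Suc (s - t)) r1 (T (Suc (s - t)))" "agree r1 r' (T (Suc (s - t)))"
      using T by blast
    then have "Q r1 s" "agree r1 r' (Suc s)" using that unfolding P_def by auto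
    then show ?thesis using stable by blast
  qed
  ultimately show ?thesis by blast
qed

section \<open>Continuations in which a fixed set of processes crashes\<close>

definition crash_at :: "nat \<Rightarrow> nat set \<Rightarrow> fpattern" where
  "crash_at t Z = (\<lambda>s. if s < t then {} else Z)"

lemma failure_pattern_crash_at: "Z \<subseteq> Pi \<Longrightarrow> failure_pattern Pi (crash_at t Z)"
  by (auto simp: failure_pattern_def crash_at_def mono_def)

lemma faulty_crash_at [simp]: "faulty (crash_at t Z) = Z"
  by (auto simp: faulty_def crash_at_def)

text \<open>The extension schedules the processes outside \<open>Z\<close> round robin. Consultation 0 is answered
  iff \<open>ans\<close>, with the value \<open>b\<close>; all later consultations stay unanswered, which is admissible because
  the members of \<open>Z\<close> never query them.\<close>

definition crash_step :: "('s, 'm) algorithm \<Rightarrow> nat \<Rightarrow> (nat \<Rightarrow> bool) \<Rightarrow> nat set \<Rightarrow> bool \<Rightarrow> bool \<Rightarrow>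
    'm schedule \<Rightarrow> nat \<Rightarrow> bool" where
  "crash_step A n V Z ans b r s \<longleftrightarrow> (let p = Suc (s mod n) in
     if p \<in> Z then sched r s = None
     else if waiting A V r s p then
       (if ans \<and> nr r s p = 0 then sched r s = Some p \<and> input r s = RespIn b else sched r s = None)
     else fair_step A V r s p)"

lemma crash_step_exists: "\<exists>a i x. crash_step A n V Z ans b (upd r s a i x) s"
proof -
  define p where "p = Suc (s mod n)"
  have a: "agree r (upd r s a i x) s" for a i x by simp
  have w: "waiting A V (upd r s a i x) s p = waiting A V r s p"
      "nr (upd r s a i x) s p = nr r s p" for a i x
    using waiting_agree[OF a] nr_agree[OF a] by (metis order_refl)+
  consider "p \<in> Z \<or> waiting A V r s p \<and> \<not> (ans \<and> nr r s p = 0)"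
    | "p \<notin> Z" "waiting A V r s p" "ans" "nr r s p = 0" | "p \<notin> Z" "\<not> waiting A V r s p"
    by blast
  then show ?thesis
  proof cases
    case 1
    then show ?thesis
      by (intro exI[of _ None] exI[of _ NullIn] exI[of _ "(0,0)"])
         (auto simp: crash_step_def Let_def w simp flip: p_def)
  next
    case 2
    then show ?thesis
      by (intro exI[of _ "Some p"] exI[of _ "RespIn b"] exI[of _ "(0,0)"])
         (auto simp: crash_step_def Let_def w simp flip: p_def)
  next
    case 3
    then obtain i x where "fair_step A V (upd r s (Some p) i x) s p" using fair_step_exists by blast
    with 3 show ?thesis
      by (intro exI[of _ "Some p"] exI[of _ i] exI[of _ x])
         (auto simp: crash_step_def Let_def w simp flip: p_def)
  qed
qed

lemma crash_step_agree:
  assumes "agree r r' (Suc s)" "crash_step A n V Z ans b r s"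
  shows "crash_step A n V Z ans b r' s"
proof -
  have "waiting A V r s p = waiting A V r' s p" "nr r s p = nr r' s p" for p
    using waiting_agree[OF assms(1)] nr_agree[OF assms(1)] by (metis le_SucI order_refl)+
  then show ?thesis
    using assms(2) fair_step_agree[OF assms(1)] agreeD[OF assms(1), of s]
    unfolding crash_step_def Let_def by (metis lessI)
qed

lemma blocked_if_never_steps:
  assumes w: "waiting A V r s p" and no: "\<And>u. u \<ge> s \<Longrightarrow> sched r u \<noteq> Some p"
  shows "blocked A V r p"
proof -
  have "waiting A V r u p" if "u \<ge> s" for u
    using that
  proof (induction u rule: dec_induct)
    case (step u)
    then show ?case using waiting_idle[OF no[of u]] by blast
  qed (rule w)
  then show ?thesis using no unfolding blocked_def by blast
qed

lemma turn_exists: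
  assumes "p \<in> {1..n}"
  shows "\<exists>s\<ge>T. Suc (s mod n) = p"
proof (intro exI conjI)
  show "T * n + (p - 1) \<ge> T" using assms by (cases n) auto
  have "p - 1 < n" using assms by auto
  then have "(T * n + (p - 1)) mod n = p - 1" by (metis mod_less mod_mult_self3)
  moreover have "Suc (p - 1) = p" using assms by simp
  ultimately show "Suc ((T * n + (p - 1)) mod n) = p" by metis
qed

text \<open>Two modes. With \<open>ans\<close>, members of \<open>Z\<close> may have queried before
  \<open>t\<close>, and consultation 0 is answered by a submitted value \<open>b\<close>. Without
  it, no member of \<open>Z\<close> has queried, and silence in every consultation is
  admissible.\<close>

locale crash_run =
  fixes A :: "('s, 'm) algorithm" and n f :: nat and V :: "nat \<Rightarrow> bool" and Z :: "nat set"
    and ans b :: bool and r :: "'m schedule" and t :: nat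
  assumes leg: "legal A {1..n} V r t"
    and Z: "Z \<subseteq> {1..n}" "card Z = f + 1"
    and ans: "ans \<Longrightarrow> \<exists>q. queried A V r t 0 q b"
    and noans: "\<not> ans \<Longrightarrow> s < t \<Longrightarrow> sched r s = Some q \<Longrightarrow> qout A V r s \<noteq> None \<Longrightarrow> q \<notin> Z"
    and step: "s \<ge> t \<Longrightarrow> crash_step A n V Z ans b r s"
    and resp: "resp r = (\<lambda>_. b)"
begin

lemma n_pos: "n > 0"
  using Z by (cases n) auto

lemma step_cases:
  assumes "sched r s = Some p" "s \<ge> t"
  obtains "p = Suc (s mod n)" "p \<notin> Z" "waiting A V r s p" "ans" "nr r s p = 0" "input r s = RespIn b"
    | "p = Suc (s mod n)" "p \<notin> Z" "fair_step A V r s p"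
  using step[OF assms(2)] assms(1)
  by (auto simp: crash_step_def Let_def fair_step_def split: if_splits)

lemma sched_ok:
  assumes "sched r s = Some p"
  shows "p \<in> {1..n}" "p \<notin> crash_at t Z s"
    "if waiting A V r s p then input r s = RespIn (resp r (nr r s p))
     else input r s = NullIn \<or> msg_ok A V r s p"
proof -
  have "p \<in> {1..n} \<and> p \<notin> crash_at t Z s \<and>
    (if waiting A V r s p then input r s = RespIn (resp r (nr r s p))
     else input r s = NullIn \<or> msg_ok A V r s p)"
  proof (cases "s < t")
    case True
    then show ?thesis using leg assms by (auto simp: legal_def crash_at_def)
  next
    case False
    have "Suc (s mod n) \<in> {1..n}" using n_pos by (simp add: Suc_leI)
    moreover have "s \<ge> t" using False by simp
    ultimately show ?thesis
      using step_cases[OF assms \<open>s \<ge> t\<close>] fair_step_ok[of A V r s p] resp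
      unfolding crash_at_def by (metis not_less)
  qed
  then show "p \<in> {1..n}" "p \<notin> crash_at t Z s"
    "if waiting A V r s p then input r s = RespIn (resp r (nr r s p))
     else input r s = NullIn \<or> msg_ok A V r s p"
    by blast+
qed

lemma msg_step:
  assumes "sched r s = Some p" "is_msg (input r s)"
  shows "msg_ok A V r s p" "s \<ge> t \<Longrightarrow> fair_step A V r s p"
proof -
  show "msg_ok A V r s p"
    using sched_ok(3)[OF assms(1)] assms(2) by (auto split: if_splits)
  show "s \<ge> t \<Longrightarrow> fair_step A V r s p"
    using step_cases[OF assms(1)] assms(2) by (metis is_msg_simps(3))
qed

lemma no_duplicates:
  assumes "sched r s \<noteq> None" "sched r s' \<noteq> None" "is_msg (input r s)" "is_msg (input r s')"
    "src r s = src r s'"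
  shows "s = s'"
proof -
  have *: "src r s \<noteq> src r s'" if h: "s < s'" "sched r s \<noteq> None" "sched r s' \<noteq> None"
    "is_msg (input r s)" "is_msg (input r s')" for s s'
  proof (cases "s' < t")
    case True
    then have "s < t" using h(1) by simp
    then show ?thesis using leg h True unfolding legal_def by (metis less_irrefl)
  next
    case False
    obtain p q where "sched r s = Some p" "sched r s' = Some q" using h(2,3) by blast
    then show ?thesis
      using fair_step_new_src msg_step h False by (metis not_less)
  qed
  show ?thesis using *[of s s'] *[of s' s] assms by (metis linorder_neqE_nat)
qed

lemma resp_step:
  assumes "sched r s = Some p" "is_resp (input r s)"
  shows "s \<ge> t" "ans" "nr r s p = 0"
proof -
  show "s \<ge> t"
  proof (rule ccontr)
    assume "\<not> s \<ge> t"
    then show False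
      using leg assms unfolding legal_def msg_ok_def by (metis is_resp_simps(1,2) not_le)
  qed
  then show "ans" "nr r s p = 0"
    using step_cases[OF assms(1)] fair_step_ok(3)[of A V r s p] assms(2) unfolding msg_ok_def
    by (metis is_resp_simps(1,2))+
qed

text \<open>A waiting process that is not to be answered gets no step, and without a step of its own
  neither its waiting status nor its response count changes.\<close>

lemma stuck_blocked:
  assumes "s \<ge> t" "waiting A V r s p" "\<not> (ans \<and> nr r s p = 0)"
  shows "blocked A V r p"
proof (rule blocked_if_never_steps[OF assms(2)])
  fix u assume "u \<ge> s"
  then have "waiting A V r u p \<and> \<not> (ans \<and> nr r u p = 0) \<and> sched r u \<noteq> Some p"
  proof (induction u rule: dec_induct)
    case base
    then show ?case using assms step_cases[of s p] fair_step_ok(2)[of A V r s p] by blast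
  next
    case (step u)
    then have "waiting A V r (Suc u) p \<and> \<not> (ans \<and> nr r (Suc u) p = 0)"
      using waiting_idle[of r u p A V] nr_idle[of r u p] by simp
    moreover have "Suc u \<ge> t" using step assms(1) by simp
    ultimately show ?case using step_cases[of "Suc u" p] fair_step_ok(2)[of A V r "Suc u" p] by blast
  qed
  then show "sched r u \<noteq> Some p" by blast
qed

lemma correct_steps:
  assumes p: "p \<in> {1..n} - Z" and nb: "\<not> blocked A V r p" and s: "s \<ge> t" "Suc (s mod n) = p"
  shows "sched r s = Some p \<and> is_resp (input r s) \<or> fair_step A V r s p"
  using step[OF s(1)] stuck_blocked[OF s(1), of p] nb s p
  by (auto simp: crash_step_def Let_def split: if_splits)

text \<open>At its turn an unblocked survivor either takes a fair step or receives the response of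
  consultation 0. The latter happens only once, so the following turn is fair.\<close>

lemma correct_fair:
  assumes p: "p \<in> {1..n} - Z" and nb: "\<not> blocked A V r p"
  shows "\<exists>s\<ge>T. fair_step A V r s p"
proof -
  obtain s where s: "s \<ge> max t T" "Suc (s mod n) = p" using turn_exists p by blast
  show ?thesis
  proof (cases "fair_step A V r s p")
    case True
    then show ?thesis using s by auto
  next
    case False
    then have s1: "sched r s = Some p" "is_resp (input r s)"
      using correct_steps[OF p nb, of s] s by auto
    obtain s' where s': "s' \<ge> Suc s" "Suc (s' mod n) = p" using turn_exists p by blast
    have "nr r s' p > 0" using nr_pos[OF s1] s'(1) by simp
    then have "fair_step A V r s' p"
      using correct_steps[OF p nb, of s'] resp_step(3)[of s' p] s s' by force
    then show ?thesis using s s' by (intro exI[of _ s']) auto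
  qed
qed

text \<open>Members of \<open>Z\<close> act only before \<open>t\<close>. With \<open>ans\<close>, a
  query to a later consultation would be a second query, made while still waiting for the first
  response, which \<open>legal\<close> forbids.\<close>

lemma queriers_alive:
  assumes "queried_ever A V r k q" "\<not> (ans \<and> k = 0)"
  shows "q \<notin> Z"
proof
  assume q: "q \<in> Z"
  obtain s c where s: "sched r s = Some q" "nq A V r s q = k" "qout A V r s = Some c"
    using assms(1) unfolding queried_ever_def by blast
  have st: "s < t" using sched_ok(2)[OF s(1)] q by (auto simp: crash_at_def split: if_splits)
  with noans s q have "ans" by fastforce
  with assms(2) s(2) have "nq A V r s q > 0" by simp
  moreover have "nr r s q = 0" using legal_nr[OF leg] st by simp
  ultimately have "waiting A V r s q" by (simp add: waiting_def)
  then show False using leg s st unfolding legal_def by blast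
qed

text \<open>The \<open>f + 1\<close> members of \<open>Z\<close> are missing, one more than the
  oracle tolerates, so its liveness condition demands nothing.\<close>

lemma few_queriers:
  assumes "\<not> (ans \<and> k = 0)"
  shows "card {q \<in> {1..n}. queried_ever A V r k q} < n - f"
proof -
  have "card {q \<in> {1..n}. queried_ever A V r k q} \<le> card ({1..n} - Z)"
    by (rule card_mono) (use queriers_alive assms in auto)
  also have "\<dots> = n - (f + 1)" using Z by (simp add: card_Diff_subset finite_subset)
  finally show ?thesis using Z card_mono[of "{1..n}" Z] by simp
qed

lemma run: "is_run A {1..n} (crash_at t Z) V (cons_problem {1..n}) f r"
  unfolding is_run_iff
proof (intro conjI)
  show "\<forall>s p. sched r s = Some p \<longrightarrow> p \<in> {1..n} \<and> p \<notin> crash_at t Z s"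
    using sched_ok by blast
  show "\<forall>s p. sched r s = Some p \<longrightarrow>
      (if waiting A V r s p then input r s = RespIn (resp r (nr r s p))
       else input r s = NullIn \<or> msg_ok A V r s p)"
    using sched_ok(3) by blast
  show "\<forall>s s'. sched r s \<noteq> None \<and> sched r s' \<noteq> None \<and> is_msg (input r s) \<and> is_msg (input r s') \<and>
      src r s = src r s' \<longrightarrow> s = s'"
    using no_duplicates by blast
  show "\<forall>s i p m. i < length (sends A V r s) \<and> sends A V r s ! i = (p, m) \<and>
      p \<in> correct {1..n} (crash_at t Z) \<longrightarrow>
      (\<exists>t'. sched r t' = Some p \<and> is_msg (input r t') \<and> src r t' = (s, i)) \<or> blocked A V r p"
  proof (intro allI impI)
    fix s i p m
    assume h: "i < length (sends A V r s) \<and> sends A V r s ! i = (p, m) \<and>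
      p \<in> correct {1..n} (crash_at t Z)"
    then have "p \<in> {1..n} - Z" by (simp add: correct_def)
    then show "(\<exists>t'. sched r t' = Some p \<and> is_msg (input r t') \<and> src r t' = (s, i)) \<or> blocked A V r p"
      using fair_delivery[of A V r p i s m] correct_fair[of p] h by blast
  qed
  show "\<forall>p\<in>correct {1..n} (crash_at t Z). (\<forall>s. \<exists>t'\<ge>s. sched r t' = Some p) \<or> blocked A V r p"
  proof
    fix p assume "p \<in> correct {1..n} (crash_at t Z)"
    then have "p \<in> {1..n} - Z" by (simp add: correct_def)
    then show "(\<forall>s. \<exists>t'\<ge>s. sched r t' = Some p) \<or> blocked A V r p"
      using correct_fair[of p] fair_step_ok(1) by blast
  qed
  show "\<forall>s p. sched r s = Some p \<and> is_resp (input r s) \<longrightarrow>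
      (\<forall>W. (\<forall>q c. queried A V r s (nr r s p) q c \<longrightarrow> W q = c) \<longrightarrow>
           resp r (nr r s p) \<in> cons_problem {1..n} (crash_at t Z) W)"
  proof (intro allI impI)
    fix s p W
    assume "sched r s = Some p \<and> is_resp (input r s)"
      and W: "\<forall>q c. queried A V r s (nr r s p) q c \<longrightarrow> W q = c"
    then have s: "s \<ge> t" "ans" "nr r s p = 0" using resp_step by blast+
    then obtain q where q: "queried A V r t 0 q b" using ans by blast
    then have "queried A V r s 0 q b" using s(1) unfolding queried_def by (meson less_le_trans)
    \<comment> \<open>If \<open>W\<close> is unanimous, its common value is that of
      \<open>q\<close>, hence \<open>b\<close>; otherwise both values are admissible.\<close>
    then have "W q = b" using W s by simp
    moreover have "q \<in> {1..n}" using q sched_ok(1) unfolding queried_def by blast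
    ultimately show "resp r (nr r s p) \<in> cons_problem {1..n} (crash_at t Z) W"
      unfolding cons_problem_def resp by auto
  qed
  show "\<forall>p k. p \<in> correct {1..n} (crash_at t Z) \<and> queried_ever A V r k p \<and>
      card {1..n} - f \<le> card {q \<in> {1..n}. queried_ever A V r k q} \<longrightarrow>
      (\<exists>s. sched r s = Some p \<and> is_resp (input r s) \<and> nr r s p = k)"
  proof (intro allI impI)
    fix p k
    assume h: "p \<in> correct {1..n} (crash_at t Z) \<and> queried_ever A V r k p \<and>
      card {1..n} - f \<le> card {q \<in> {1..n}. queried_ever A V r k q}"
    then have p: "p \<in> {1..n} - Z" by (simp add: correct_def)
    have "ans \<and> k = 0" using few_queriers[of k] h by (metis card_atLeastAtMost diff_Suc_1 not_less)
    then have k: "ans" "k = 0" by blast+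
    obtain s c where s: "sched r s = Some p" "qout A V r s = Some c"
      using h unfolding queried_ever_def by blast
    show "\<exists>s. sched r s = Some p \<and> is_resp (input r s) \<and> nr r s p = k"
    proof (rule ccontr)
      \<comment> \<open>An unanswered first query keeps the response count at 0, so the next turn of
        \<open>p\<close> after its query and after \<open>t\<close> would deliver the
        response.\<close>
      assume never: "\<not> ?thesis"
      then have "nr r u p = 0" for u
        using k resp_step(3)[of _ p] nr_eq_0_iff[of r u p] by blast
      moreover obtain u where u: "u \<ge> max t (Suc s)" "Suc (u mod n) = p"
        using turn_exists p by blast
      moreover have "nq A V r u p > 0" using nq_pos[OF s(1), of A V u] s(2) u(1) by simp
      ultimately show False
        using step[of u] p k never by (auto simp: crash_step_def waiting_def)
    qed
  qed
qed

lemma waiting_never_steps: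
  assumes "\<not> ans" "s \<ge> t" "sched r s = Some p"
  shows "\<not> waiting A V r s p"
  using step_cases[OF assms(3,2)] fair_step_ok(2)[of A V r s p] assms(1) by blast

end

lemma crash_extension:
  assumes "legal A {1..n} V r t" "Z \<subseteq> {1..n}" "card Z = f + 1"
    and "ans \<Longrightarrow> \<exists>q. queried A V r t 0 q b"
    and "\<And>s q. \<not> ans \<Longrightarrow> s < t \<Longrightarrow> sched r s = Some q \<Longrightarrow> qout A V r s \<noteq> None \<Longrightarrow> q \<notin> Z"
  shows "\<exists>r'. agree r r' t \<and> is_run A {1..n} (crash_at t Z) V (cons_problem {1..n}) f r' \<and>
    (\<not> ans \<longrightarrow> (\<forall>s\<ge>t. \<forall>p. sched r' s = Some p \<longrightarrow> \<not> waiting A V r' s p))"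
proof -
  obtain r1 where r1: "agree r r1 t" "\<forall>s\<ge>t. crash_step A n V Z ans b r1 s"
    using extend_schedule[of "crash_step A n V Z ans b" r t, OF crash_step_exists]
      crash_step_agree[of _ _ _ A n V Z ans b] by blast
  \<comment> \<open>\<open>agree\<close> ignores \<open>resp\<close>: responses influence a run only
    through the inputs, so this component can be fixed afterwards.\<close>
  define r' where "r' = r1\<lparr>resp := (\<lambda>_. b)\<rparr>"
  have a1: "agree r1 r' u" for u by (simp add: agree_def r'_def)
  have a: "agree r r' t" using r1(1) a1 agree_trans by blast
  interpret crash_run A n f V Z ans b r' t
  proof
    show "legal A {1..n} V r' t" using legal_agree[OF a assms(1)] .
    show "crash_step A n V Z ans b r' s" if "s \<ge> t" for s
      using crash_step_agree[OF a1] r1(2) that by blast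
    show "\<exists>q. queried A V r' t 0 q b" if ans: "ans"
    proof -
      obtain q u where "u < t" "sched r u = Some q" "nq A V r u q = 0" "qout A V r u = Some b"
        using assms(4)[OF ans] unfolding queried_def by blast
      then show ?thesis
        using agreeD[OF a] nq_agree[OF a, of u A V q] qout_agree[OF a, of u A V]
        unfolding queried_def by (metis less_imp_le)
    qed
    show "q \<notin> Z" if "\<not> ans" "s < t" "sched r' s = Some q" "qout A V r' s \<noteq> None" for s q
      using assms(5) that agreeD[OF a] qout_agree[OF a] by metis
  qed (use assms in \<open>auto simp: r'_def\<close>)
  show ?thesis using a run waiting_never_steps by blast
qed

section \<open>Undecided processes cannot query\<close>

locale reduction =
  fixes A :: "('s, 'm) algorithm" and n f :: nat
  assumes f: "1 \<le> f" "f + 2 \<le> n"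
    and solves: "solves_with A {1..n} (Cons_task n (f + 1)) (Cons_task n f)"
begin

definition run :: "fpattern \<Rightarrow> (nat \<Rightarrow> bool) \<Rightarrow> 'm schedule \<Rightarrow> bool" where
  "run F V r \<longleftrightarrow> failure_pattern {1..n} F \<and> card (faulty F) \<le> f + 1
     \<and> is_run A {1..n} F V (cons_problem {1..n}) f r"

definition dec :: "(nat \<Rightarrow> bool) \<Rightarrow> 'm schedule \<Rightarrow> nat \<Rightarrow> nat \<Rightarrow> bool option" where
  "dec V r t p = a_dec A p (cfg A V r t p)"

definition poss :: "(nat \<Rightarrow> bool) \<Rightarrow> 'm schedule \<Rightarrow> nat \<Rightarrow> bool set" where
  "poss V r t = {v. \<exists>F r' p s. run F V r' \<and> agree r r' t \<and> p \<in> {1..n} \<and> dec V r' s p = Some v}"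

lemma run_solves:
  assumes "run F V r"
  shows "(\<forall>p\<in>correct {1..n} F. \<exists>t d. dec V r t p = Some d)
      \<and> (\<forall>p\<in>{1..n}. \<forall>t t' d. t \<le> t' \<and> dec V r t p = Some d \<longrightarrow> dec V r t' p = Some d)
      \<and> (\<forall>p\<in>{1..n}. \<forall>q\<in>{1..n}. \<forall>t t' d d'. dec V r t p = Some d
            \<and> dec V r t' q = Some d' \<longrightarrow> d = d')
      \<and> (\<forall>p\<in>{1..n}. \<forall>t d. dec V r t p = Some d \<longrightarrow> d \<in> cons_problem {1..n} F V)"
  using solves assms unfolding solves_with_def Cons_task_def run_def dec_def fst_conv snd_conv
  by blast

lemma run_sched:
  assumes "run F V r" "sched r s = Some p"
  shows "p \<in> {1..n}"
proof -
  have "is_run A {1..n} F V (cons_problem {1..n}) f r" using assms(1) unfolding run_def by blast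
  from this[unfolded is_run_iff, THEN conjunct1] assms(2) show ?thesis by blast
qed

lemma terminates: "run F V r \<Longrightarrow> p \<in> {1..n} \<Longrightarrow> p \<notin> faulty F \<Longrightarrow> \<exists>t d. dec V r t p = Some d"
  using run_solves[of F V r] unfolding correct_def by blast

lemma irrevocable:
  "run F V r \<Longrightarrow> p \<in> {1..n} \<Longrightarrow> dec V r t p = Some d \<Longrightarrow> t \<le> t' \<Longrightarrow> dec V r t' p = Some d"
  using run_solves[of F V r] by blast

lemma agreement:
  "run F V r \<Longrightarrow> p \<in> {1..n} \<Longrightarrow> q \<in> {1..n} \<Longrightarrow> dec V r t p = Some d \<Longrightarrow> dec V r t' q = Some d' \<Longrightarrow> d = d'"
  using run_solves[of F V r] by blast

lemma validity:
  "run F V r \<Longrightarrow> p \<in> {1..n} \<Longrightarrow> dec V r t p = Some d \<Longrightarrow> d \<in> cons_problem {1..n} F V"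
  using run_solves[of F V r] by blast

lemma dec_agree: "agree r r' t \<Longrightarrow> s \<le> t \<Longrightarrow> dec V r s p = dec V r' s p"
  unfolding dec_def using cfg_agree by metis

lemma poss_mono:
  assumes "agree r r' t" "t \<le> t'"
  shows "poss V r' t' \<subseteq> poss V r t"
proof -
  have "agree r r1 t" if "agree r' r1 t'" for r1
    using agree_trans[OF assms(1) agree_mono[OF that assms(2)]] .
  then show ?thesis unfolding poss_def by blast
qed

lemma poss_decided:
  assumes "dec V r s p = Some v" "s \<le> t" "p \<in> {1..n}" "w \<in> poss V r t"
  shows "w = v"
proof -
  obtain F r' q u where r': "run F V r'" "agree r r' t" "q \<in> {1..n}" "dec V r' u q = Some w"
    using assms(4) unfolding poss_def by blast
  have "dec V r' s p = Some v" using dec_agree[OF r'(2) assms(2), of V p] assms(1) by simp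
  then show ?thesis using agreement[OF r'(1,3) assms(3) r'(4)] by blast
qed

lemma crash_superset:
  assumes "S \<subseteq> {1..n}" "card S \<le> f + 1"
  shows "\<exists>Z. S \<subseteq> Z \<and> Z \<subseteq> {1..n} \<and> card Z = f + 1"
  using exists_subset_between[OF assms(2) _ assms(1)] f by auto

lemma crash_avoiding:
  assumes "p \<in> {1..n}"
  shows "\<exists>Z. p \<notin> Z \<and> Z \<subseteq> {1..n} \<and> card Z = f + 1"
proof -
  have "f + 1 \<le> card ({1..n} - {p})" using f assms by simp
  then obtain Z where "Z \<subseteq> {1..n} - {p}" "card Z = f + 1" by (meson obtain_subset_with_card_n)
  then show ?thesis by blast
qed

lemma run_crash_at:
  assumes "Z \<subseteq> {1..n}" "card Z = f + 1" "is_run A {1..n} (crash_at t Z) V (cons_problem {1..n}) f r"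
  shows "run (crash_at t Z) V r"
  using assms unfolding run_def by (simp add: failure_pattern_crash_at)

lemma silent_extension:
  assumes "legal A {1..n} V r t" "Z \<subseteq> {1..n}" "card Z = f + 1"
    "\<And>s q. s < t \<Longrightarrow> sched r s = Some q \<Longrightarrow> qout A V r s \<noteq> None \<Longrightarrow> q \<notin> Z"
  shows "\<exists>r'. agree r r' t \<and> run (crash_at t Z) V r' \<and>
    (\<forall>s\<ge>t. \<forall>p. sched r' s = Some p \<longrightarrow> p \<notin> Z \<and> \<not> waiting A V r' s p)"
proof -
  obtain r' where r': "agree r r' t" "is_run A {1..n} (crash_at t Z) V (cons_problem {1..n}) f r'"
      "\<forall>s\<ge>t. \<forall>p. sched r' s = Some p \<longrightarrow> \<not> waiting A V r' s p"
    using crash_extension[OF assms(1-3), of False] assms(4) by blast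
  moreover have "p \<notin> Z" if "s \<ge> t" "sched r' s = Some p" for s p
    using r'(2) that unfolding is_run_iff crash_at_def by (metis not_less)
  ultimately show ?thesis using run_crash_at assms(2,3) by blast
qed

text \<open>Once there are queries, a crashing set that avoids all queriers may not exist. The first
  query always belongs to consultation 0, and its value then serves as the answer.\<close>

lemma legal_extends:
  assumes "legal A {1..n} V r t"
  shows "\<exists>F r'. run F V r' \<and> agree r r' t"
proof -
  obtain Z where Z: "Z \<subseteq> {1..n}" "card Z = f + 1" using crash_superset[of "{}"] by auto
  show ?thesis
  proof (cases "\<exists>s<t. qout A V r s \<noteq> None")
    case False
    then show ?thesis using silent_extension[OF assms Z] by blast
  next
    case True
    define s where "s = (LEAST s. s < t \<and> qout A V r s \<noteq> None)"
    have s: "s < t" "qout A V r s \<noteq> None" "\<And>u. u < s \<Longrightarrow> qout A V r u = None"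
      using LeastI_ex[OF True] not_less_Least[of _ "\<lambda>s. s < t \<and> qout A V r s \<noteq> None"]
      unfolding s_def[symmetric] by (blast, blast, metis less_trans)
    then obtain q c where "sched r s = Some q" "qout A V r s = Some c"
      using qout_None_idle[of r s A V] by (metis not_None_eq)
    moreover have "nq A V r s q = 0" using s(3) by (simp add: nq_eq_0_iff)
    ultimately have "queried A V r t 0 q c" using s(1) unfolding queried_def by blast
    then show ?thesis
      using crash_extension[OF assms Z, of True c] run_crash_at[OF Z] by blast
  qed
qed

lemma poss_extends:
  assumes "legal A {1..n} V r t" "p \<in> {1..n}" "dec V r t p = Some v"
  shows "v \<in> poss V r t"
proof -
  obtain F r' where r': "run F V r'" "agree r r' t" using legal_extends[OF assms(1)] by blast
  then have "dec V r' t p = Some v" using dec_agree[OF r'(2), of t V p] assms(3) by simp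
  then show ?thesis using r' assms(2) unfolding poss_def by blast
qed

lemma poss_nonempty:
  assumes "legal A {1..n} V r t"
  shows "\<exists>v. v \<in> poss V r t"
proof -
  obtain F r' where r': "run F V r'" "agree r r' t" using legal_extends[OF assms(1)] by blast
  have "card (faulty F) < card {1..n}" using r'(1) f unfolding run_def by simp
  moreover have "finite (faulty F)"
    using r'(1) finite_subset[of "faulty F" "{1..n}"]
    unfolding run_def failure_pattern_def faulty_def by blast
  ultimately obtain p where "p \<in> {1..n}" "p \<notin> faulty F"
    by (meson card_mono leD subsetI)
  then show ?thesis using terminates[OF r'(1)] r' unfolding poss_def by blast
qed

text \<open>The last slot \<open>T - 1\<close> may contain a query: its author would violate
  \<open>legal\<close> only by a later step.\<close>

lemma run_legal:
  assumes "run F V r" "\<And>u. Suc u < T \<Longrightarrow> qout A V r u = None"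
  shows "legal A {1..n} V r T"
proof -
  have "\<not> waiting A V r s p" if "s < T" for s p
    using assms(2) that by (intro not_waiting_if_no_query) (simp add: nq_eq_0_iff)
  then show ?thesis
    using assms(1) unfolding run_def is_run_iff legal_def by (metis (no_types, lifting))
qed

text \<open>If \<open>f + 1\<close> processes other than the first querier crash before querying, the oracle may stay
  silent and the querier is blocked for ever.\<close>

lemma query_decides:
  assumes leg: "legal A {1..n} V r (Suc s)" and none: "\<And>u. u < s \<Longrightarrow> qout A V r u = None"
    and p: "sched r s = Some p" "qout A V r s \<noteq> None"
  shows "dec V r (Suc s) p \<noteq> None"
proof -
  have pn: "p \<in> {1..n}" using leg p unfolding legal_def by blast
  then obtain Z where Z: "p \<notin> Z" "Z \<subseteq> {1..n}" "card Z = f + 1" using crash_avoiding by blast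
  have "q \<notin> Z" if "u < Suc s" "sched r u = Some q" "qout A V r u \<noteq> None" for u q
    using that none p Z less_Suc_eq by auto
  then obtain r' where r': "agree r r' (Suc s)" "run (crash_at (Suc s) Z) V r'"
      "\<And>u q. u \<ge> Suc s \<Longrightarrow> sched r' u = Some q \<Longrightarrow> \<not> waiting A V r' u q"
    using silent_extension[OF leg Z(2,3)] by blast
  have "nr r' (Suc s) p = 0" using legal_nr[OF legal_agree[OF r'(1) leg]] by simp
  moreover have "nq A V r' (Suc s) p > 0"
    using nq_agree[OF r'(1), of "Suc s" A V p] nq_pos[OF p, of "Suc s"] by simp
  ultimately have w: "waiting A V r' (Suc s) p" by (simp add: waiting_def)
  have w': "waiting A V r' u p" if "u \<ge> Suc s" for u
    using that
  proof (induction u rule: dec_induct)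
    case (step u)
    then have "sched r' u \<noteq> Some p" using r'(3)[of u p] by auto
    then show ?case using step waiting_idle by metis
  qed (rule w)
  obtain T d where T: "dec V r' T p = Some d"
    using terminates[OF r'(2) pn] Z(1) by auto
  \<comment> \<open>Being blocked, \<open>p\<close> keeps its state from \<open>Suc s\<close> on, so
    the decision that it owes as a correct process is already visible there.\<close>
  have "dec V r' (Suc s) p = Some d"
  proof (cases "T \<le> Suc s")
    case True
    then show ?thesis using irrevocable[OF r'(2) pn T] by blast
  next
    case False
    have "cfg A V r' T p = cfg A V r' (Suc s) p"
      using cfg_idle[of "Suc s" T r' p A V] r'(3) w' False by (metis nat_le_linear)
    then show ?thesis using T unfolding dec_def by simp
  qed
  then show ?thesis using dec_agree[OF r'(1), of "Suc s" V p] by simp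
qed

lemma no_early_query:
  assumes r: "run F V r" and pre: "\<And>u. u < t \<Longrightarrow> qout A V r u = None"
    and undec: "\<And>u q. t \<le> u \<Longrightarrow> Suc u < T \<Longrightarrow> sched r u = Some q \<Longrightarrow> dec V r (Suc u) q = None"
    and T: "Suc s < T"
  shows "qout A V r s = None"
proof -
  have "Suc u < T \<longrightarrow> qout A V r u = None" for u
  proof (induction u rule: less_induct)
    case (less u)
    show ?case
    proof (rule impI, rule ccontr)
      assume u: "Suc u < T" and q: "qout A V r u \<noteq> None"
      have none: "qout A V r u' = None" if "u' < u" for u'
      proof -
        have "Suc u' < T" using that u by linarith
        then show ?thesis using less[OF that] by blast
      qed
      have leg: "legal A {1..n} V r (Suc u)"
        by (rule run_legal[OF r]) (rule none, simp)
      obtain p where p: "sched r u = Some p" using q qout_None_idle by (metis not_None_eq)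
      have "dec V r (Suc u) p \<noteq> None" using query_decides[OF leg none p q] by blast
      moreover have "t \<le> u"
      proof (rule ccontr)
        assume "\<not> t \<le> u"
        then show False using pre[of u] q by simp
      qed
      ultimately show False using undec[of u p] u p by simp
    qed
  qed
  then show ?thesis using T by blast
qed

section \<open>Valency\<close>

text \<open>Two successors of the same query-free prefix share a possible value: crash the (at most two)
  processes that distinguish them together with \<open>f - 1\<close> others, and let the remaining processes
  decide without the oracle. The idle slots \<open>t\<close> and \<open>Suc t\<close> leave room for the steps of the successors,
  so that no message identifier changes.\<close>

lemma common_value:
  assumes leg: "legal A {1..n} V r t" and free: "\<And>u. u < t \<Longrightarrow> qout A V r u = None"
    and pq: "p \<in> {1..n}" "q \<in> {1..n}"
  shows "\<exists>v. \<forall>r1. agree r r1 t \<and> legal A {1..n} V r1 (Suc (Suc t)) \<and>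
    sched r1 t \<in> {None, Some p, Some q} \<and> sched r1 (Suc t) \<in> {None, Some p, Some q} \<longrightarrow>
    v \<in> poss V r1 (Suc (Suc t))"
proof -
  define t2 where "t2 = Suc (Suc t)"
  \<comment> \<open>This is where \<open>1 \<le> f\<close> enters: two processes may crash.\<close>
  have "card {p, q} \<le> f + 1" using f card_insert_le_m1[of 2 "{q}" p] by simp
  then obtain Z where Z: "{p, q} \<subseteq> Z" "Z \<subseteq> {1..n}" "card Z = f + 1"
    using crash_superset[of "{p, q}"] pq by auto
  define r0 where "r0 = upd (upd r t None NullIn (0, 0)) (Suc t) None NullIn (0, 0)"
  have a0: "agree r r0 t" by (simp add: r0_def agree_def)
  have idle0: "sched r0 t = None" "sched r0 (Suc t) = None" by (simp_all add: r0_def)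
  have leg0: "legal A {1..n} V r0 t2"
    unfolding t2_def using legal_idle legal_agree[OF a0 leg] idle0 by blast
  have free0: "qout A V r0 u = None" if "u < t2" for u
  proof -
    consider "u < t" | "u = t" | "u = Suc t" using \<open>u < t2\<close> unfolding t2_def by linarith
    then show ?thesis
      using free[of u] qout_agree[OF a0, of u A V] idle0 qout_None_idle[of r0 u A V] by cases auto
  qed
  have "\<exists>R. agree r0 R t2 \<and> run (crash_at t2 Z) V R \<and>
      (\<forall>s\<ge>t2. \<forall>x. sched R s = Some x \<longrightarrow> x \<notin> Z \<and> \<not> waiting A V R s x)"
    by (rule silent_extension[OF leg0 Z(2,3)]) (simp add: free0)
  then obtain R where R: "agree r0 R t2" "run (crash_at t2 Z) V R"
      "\<And>s x. s \<ge> t2 \<Longrightarrow> sched R s = Some x \<Longrightarrow> x \<notin> Z"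
    by blast
  have a: "agree r R t" using agree_trans[OF a0 agree_mono[OF R(1)]] by (simp add: t2_def)
  have idle: "sched R t = None" "sched R (Suc t) = None"
    using agreeD(1)[OF R(1), of t] agreeD(1)[OF R(1), of "Suc t"] idle0 by (simp_all add: t2_def)
  have "card Z < card {1..n}" using Z f by simp
  then obtain x0 where "x0 \<in> {1..n}" "x0 \<notin> Z"
    by (meson Z(2) card_mono finite_atLeastAtMost finite_subset leD subsetI)
  then have ex: "\<exists>T. \<exists>x\<in>{1..n} - Z. dec V R T x \<noteq> None"
    using terminates[OF R(2), of x0] by fastforce
  \<comment> \<open>The earliest decision among survivors: before it every process stepping after
    \<open>t2\<close> is undecided, so \<open>no_early_query\<close> applies.\<close>
  define T0 where "T0 = (LEAST T. \<exists>x\<in>{1..n} - Z. dec V R T x \<noteq> None)"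
  obtain x v where x: "x \<in> {1..n}" "x \<notin> Z" "dec V R T0 x = Some v"
    using LeastI_ex[OF ex] unfolding T0_def by blast
  have before: "dec V R T y = None" if "T < T0" "y \<in> {1..n}" "y \<notin> Z" for T y
    using not_less_Least that unfolding T0_def by blast
  \<comment> \<open>A survivor may have decided before \<open>t2\<close>; the maximum makes the
    prefix cover the two successor slots in any case.\<close>
  define T where "T = max T0 t2"
  have xT: "dec V R T x = Some v" using irrevocable[OF R(2) x(1,3)] by (simp add: T_def)
  have freeR: "qout A V R u = None" if "Suc u < T" for u
  proof (cases "Suc u < T0")
    case True
    show ?thesis
    proof (rule no_early_query[OF R(2) _ _ True])
      show "qout A V R u = None" if "u < t2" for u
        using free0[OF that] qout_agree[OF R(1) that, of A V] by simp
      show "dec V R (Suc u) y = None" if "t2 \<le> u" "Suc u < T0" "sched R u = Some y" for u y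
        using before[OF that(2)] R(3)[OF that(1,3)] run_sched[OF R(2) that(3)] by blast
    qed
  next
    case False
    then have "u < t2" using that by (auto simp: T_def)
    then show ?thesis using free0 qout_agree[OF R(1), of u A V] by simp
  qed
  have legR: "legal A {1..n} V R T" using run_legal[OF R(2) freeR] by blast
  have "v \<in> poss V r1 t2"
    if r1: "agree r r1 t" "legal A {1..n} V r1 t2" "sched r1 t \<in> {None, Some p, Some q}"
      "sched r1 (Suc t) \<in> {None, Some p, Some q}" for r1
  proof -
    \<comment> \<open>Splice: the successor's two slots followed by the silent continuation.
      Messages sent in those slots to survivors just remain undelivered up to \<open>T\<close>,
      which legality of a prefix allows.\<close>
    define m where "m = R\<lparr>sched := (\<lambda>s. if s < t2 then sched r1 s else sched R s),
        input := (\<lambda>s. if s < t2 then input r1 s else input R s),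
        src := (\<lambda>s. if s < t2 then src r1 s else src R s)\<rparr>"
    have m1: "agree r1 m t2" by (simp add: agree_def m_def)
    have m2: "sched m s = sched R s" "input m s = input R s" "src m s = src R s" if "s \<ge> t2" for s
      using that by (simp_all add: m_def)
    have mR: "agree m R t"
      using agree_trans[OF agree_sym[OF agree_mono[OF m1]] agree_trans[OF agree_sym[OF r1(1)] a]]
      by (simp add: t2_def)
    have mZ: "y \<in> Z" if "sched m s = Some y" "t \<le> s" "s < t2" for s y
    proof -
      have "s = t \<or> s = Suc t" using \<open>t \<le> s\<close> \<open>s < t2\<close> unfolding t2_def by linarith
      then show ?thesis using that r1(3,4) Z(1) by (auto simp: m_def)
    qed
    have RZ: "sched R s = None" if "t \<le> s" "s < t2" for s
    proof -
      have "s = t \<or> s = Suc t" using \<open>t \<le> s\<close> \<open>s < t2\<close> unfolding t2_def by linarith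
      then show ?thesis using idle by blast
    qed
    have cfgm: "cfg A V m s y = cfg A V R s y" if "y \<notin> Z" for s y
    proof (induction s)
      case (Suc s)
      consider "s < t" | "t \<le> s" "s < t2" | "t2 \<le> s" by linarith
      then show ?case
      proof cases
        case 1
        then show ?thesis using cfg_agree[OF mR, of "Suc s" A V] by simp
      next
        case 2
        then have "sched m s \<noteq> Some y" using mZ that by blast
        then show ?thesis using Suc RZ[OF 2] by (auto split: option.split)
      next
        case 3
        then show ?thesis using Suc m2[OF 3] by (auto split: option.split)
      qed
    qed simp
    have outm: "sends A V m s = sends A V R s" "qout A V m s = qout A V R s"
      if "s < t \<or> t2 \<le> s" for s
    proof -
      have "sends A V m s = sends A V R s \<and> qout A V m s = qout A V R s"
      proof (cases "s < t")
        case True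
        then show ?thesis using sends_agree[OF mR, of s A V] qout_agree[OF mR, of s A V] by simp
      next
        case False
        then have s: "t2 \<le> s" using that by blast
        then show ?thesis
          using m2[OF s] cfgm[OF R(3)[OF s]] by (auto simp: sends_def qout_def split: option.split)
      qed
      then show "sends A V m s = sends A V R s" "qout A V m s = qout A V R s" by blast+
    qed
    have stepm: "y \<in> {1..n} \<and> \<not> waiting A V m s y \<and> (input m s = NullIn \<or> msg_ok A V m s y)"
      if s: "t2 \<le> s" "s < T" "sched m s = Some y" for s y
    proof -
      have sR: "sched R s = Some y" using s m2 by simp
      have yZ: "y \<notin> Z" using R(3) sR s by blast
      have "qout A V m u = None" if "u < s" "sched m u = Some y" for u
      proof -
        have "u < t \<or> t2 \<le> u" using mZ that yZ not_less by blast
        moreover have "Suc u < T" using that s by simp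
        ultimately show ?thesis using outm(2) freeR by simp
      qed
      then have "\<not> waiting A V m s y"
        by (intro not_waiting_if_no_query) (simp add: nq_eq_0_iff)
      moreover have "msg_ok A V m s y" if ok: "msg_ok A V R s y"
      proof -
        obtain z c where z: "input R s = MsgIn z c" "fst (src R s) < s" "sched R (fst (src R s)) = Some z"
          "snd (src R s) < length (sends A V R (fst (src R s)))"
          "sends A V R (fst (src R s)) ! snd (src R s) = (y, c)"
          using ok unfolding msg_ok_def by blast
        define u where "u = fst (src R s)"
        have "\<not> (t \<le> u \<and> u < t2)" using RZ z(3) unfolding u_def by force
        then have u: "u < t \<or> t2 \<le> u" by linarith
        then have "sched m u = sched R u" using agreeD(1)[OF mR] m2 by blast
        then show ?thesis
          using z outm(1)[OF u] m2[OF s(1)] unfolding msg_ok_def u_def by metis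
      qed
      moreover have "y \<in> {1..n} \<and> (input R s = NullIn \<or> msg_ok A V R s y)"
        using legR sR s(2) unfolding legal_def by blast
      ultimately show ?thesis using m2[OF s(1)] by auto
    qed
    have legm1: "legal A {1..n} V m t2" using legal_agree[OF m1 r1(2)] .
    have okm: "y \<in> {1..n} \<and> \<not> waiting A V m s y \<and> (input m s = NullIn \<or> msg_ok A V m s y)"
      if "s < T" "sched m s = Some y" for s y
      using stepm[of s y] legm1 that unfolding legal_def by (meson not_less)
    have dup: "src m s \<noteq> src m s'"
      if h: "s < s'" "s' < T" "sched m s \<noteq> None" "sched m s' \<noteq> None" "is_msg (input m s)" "is_msg (input m s')"
      for s s'
    proof -
      consider "s' < t2" | "t2 \<le> s'" "s < t \<or> t2 \<le> s" | "t2 \<le> s'" "t \<le> s" "s < t2" by linarith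
      then show ?thesis
      proof cases
        case 1
        then have "s < t2" using h(1) by simp
        with 1 show ?thesis using legm1 h unfolding legal_def by (metis less_irrefl)
      next
        case 2
        have "sched m s = sched R s" "input m s = input R s" "src m s = src R s"
          using 2(2) agreeD[OF mR] m2 by blast+
        moreover have "s < T" using h by simp
        ultimately show ?thesis
          using legR h m2[OF 2(1)] unfolding legal_def by (metis less_irrefl)
      next
        case 3
        \<comment> \<open>The earlier receiver lies in \<open>Z\<close> and the later one does not,
          so they cannot receive the same message.\<close>
        obtain y y' where y: "sched m s = Some y" "sched m s' = Some y'" using h(3,4) by blast
        have "y \<in> Z" using mZ y(1) 3 by blast
        moreover have "y' \<notin> Z" using R(3)[OF 3(1)] m2(1)[OF 3(1)] y(2) by simp
        moreover have "s < T" using h by simp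
        then have "msg_ok A V m s y" "msg_ok A V m s' y'"
          using okm y h(2,5,6) by (metis is_msg_simps(1))+
        ultimately show ?thesis using msg_ok_same_src by blast
      qed
    qed
    have legm: "legal A {1..n} V m T"
      unfolding legal_def
    proof (intro conjI allI impI)
      fix s s'
      assume "s < T" "s' < T" "sched m s \<noteq> None \<and> sched m s' \<noteq> None \<and>
        is_msg (input m s) \<and> is_msg (input m s') \<and> src m s = src m s'"
      then show "s = s'" using dup[of s s'] dup[of s' s] by (metis linorder_neqE_nat)
    qed (use okm in blast)+
    have "dec V m T x = Some v" using xT cfgm[OF x(2)] unfolding dec_def by simp
    then have "v \<in> poss V m T" using poss_extends[OF legm x(1)] by blast
    then show "v \<in> poss V r1 t2"
      using poss_mono[OF m1, of T V] unfolding T_def by auto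
  qed
  then show ?thesis unfolding t2_def by blast
qed

text \<open>If \<open>p\<close> crashes at time 0, nobody ever sees its initial value, so one
  schedule is a run for both vectors with the same decisions of the survivors.\<close>

lemma initial_common_value:
  assumes p: "p \<in> {1..n}" and V: "\<And>x. x \<noteq> p \<Longrightarrow> V x = V' x"
  shows "\<exists>v. v \<in> poss V r 0 \<and> v \<in> poss V' r 0"
proof -
  obtain Z where Z: "p \<in> Z" "Z \<subseteq> {1..n}" "card Z = f + 1"
    using crash_superset[of "{p}"] p f by auto
  have leg: "legal A {1..n} V r 0" by (simp add: legal_def)
  obtain R where R: "agree r R 0" "run (crash_at 0 Z) V R" "\<And>s x. sched R s = Some x \<Longrightarrow> x \<notin> Z"
    using silent_extension[OF leg Z(2,3)] by blast
  have cfgR: "cfg A V R s x = cfg A V' R s x" if "x \<noteq> p" for s x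
  proof (induction s)
    case 0
    then show ?case using V that by simp
  next
    case (Suc s)
    have "sched R s \<noteq> Some p" using R(3)[of s p] Z(1) by blast
    with Suc show ?case by (auto split: option.split)
  qed
  have step_ne: "x \<noteq> p" if "sched R s = Some x" for s x using R(3)[OF that] Z(1) by blast
  have out: "sends A V R s = sends A V' R s" "qout A V R s = qout A V' R s" for s
    using cfgR[OF step_ne] by (auto simp: sends_def qout_def split: option.split)
  have nqR: "nq A V R s x = nq A V' R s x" for s x
    unfolding nq_def out ..
  have wR: "waiting A V R s x = waiting A V' R s x" for s x
    unfolding waiting_def nqR ..
  have "is_run A {1..n} (crash_at 0 Z) V (cons_problem {1..n}) f R
      = is_run A {1..n} (crash_at 0 Z) V' (cons_problem {1..n}) f R"
    unfolding is_run_def blocked_def queried_def queried_ever_def wR nqR out ..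
  then have R': "run (crash_at 0 Z) V' R" using R(2) unfolding run_def by blast
  have "card Z < card {1..n}" using Z f by simp
  then obtain x where x: "x \<in> {1..n}" "x \<notin> Z"
    by (meson Z(2) card_mono finite_atLeastAtMost finite_subset leD subsetI)
  then obtain T v where v: "dec V R T x = Some v" using terminates[OF R(2), of x] by auto
  have "x \<noteq> p" using x Z(1) by blast
  then have "dec V' R T x = Some v" using v cfgR unfolding dec_def by simp
  with v show ?thesis using R(1,2) R' x(1) unfolding poss_def by blast
qed

section \<open>Bivalent prefixes and the undecided run\<close>

definition bivalent :: "(nat \<Rightarrow> bool) \<Rightarrow> 'm schedule \<Rightarrow> nat \<Rightarrow> bool" where
  "bivalent V r t \<longleftrightarrow> (\<forall>v. v \<in> poss V r t)"

lemma not_bivalent: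
  assumes "\<not> bivalent V r t" "v \<in> poss V r t"
  shows "(\<not> v) \<notin> poss V r t"
proof -
  obtain w where w: "w \<notin> poss V r t" using assms(1) unfolding bivalent_def by blast
  have "w \<noteq> v"
  proof
    assume "w = v"
    with w assms(2) show False by simp
  qed
  then have "w = (\<not> v)" by blast
  with w show ?thesis by simp
qed

lemma poss_constant:
  assumes "\<And>x. x \<in> {1..n} \<Longrightarrow> V x = c" "v \<in> poss V r t"
  shows "v = c"
proof -
  obtain F r' q s where r': "run F V r'" "q \<in> {1..n}" "dec V r' s q = Some v"
    using assms(2) unfolding poss_def by blast
  then have "v \<in> cons_problem {1..n} F V" using validity by blast
  then show ?thesis using assms(1) r'(2) unfolding cons_problem_def by (auto split: if_splits)
qed

text \<open>Interpolation from all \<open>False\<close> to all \<open>True\<close>, changing one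
  process at a time: if every vector were univalent, shared values would carry \<open>False\<close>
  along the whole chain, against validity at its end.\<close>

lemma initial_bivalent: "\<exists>V. bivalent V r 0"
proof (rule ccontr)
  assume no: "\<not> ?thesis"
  have leg: "legal A {1..n} V r 0" for V by (simp add: legal_def)
  define W where "W = (\<lambda>j x. x \<le> (j::nat))"
  have "j \<le> n \<Longrightarrow> True \<notin> poss (W j) r 0" for j
  proof (induction j)
    case 0
    show ?case using poss_constant[of "W 0" False True] by (auto simp: W_def)
  next
    case (Suc j)
    have "W j x = W (Suc j) x" if "x \<noteq> Suc j" for x using that by (auto simp: W_def)
    then obtain v where v: "v \<in> poss (W j) r 0" "v \<in> poss (W (Suc j)) r 0"
      using initial_common_value[of "Suc j" "W j" "W (Suc j)" r] Suc.prems by auto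
    then have "v = False" using Suc by (cases v) auto
    then show ?case using v(2) not_bivalent[of "W (Suc j)" r 0 False] no by auto
  qed
  then have "True \<notin> poss (W n) r 0" by blast
  moreover obtain v where "v \<in> poss (W n) r 0" using poss_nonempty[OF leg] by blast
  moreover have "v = True" using poss_constant[of "W n" True v] \<open>v \<in> poss (W n) r 0\<close> by (auto simp: W_def)
  ultimately show False by simp
qed

lemma bivalent_undecided:
  assumes "bivalent V r t" "s \<le> t" "p \<in> {1..n}"
  shows "dec V r s p = None"
proof (rule ccontr)
  assume "dec V r s p \<noteq> None"
  then obtain v where "dec V r s p = Some v" by blast
  then have "(\<not> v) = v"
    using poss_decided[of V r s p v t "\<not> v"] assms unfolding bivalent_def by blast
  then show False by simp
qed

lemma bivalent_no_query:
  assumes leg: "legal A {1..n} V r t" and biv: "bivalent V r t"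
  shows "u < t \<Longrightarrow> qout A V r u = None"
proof (induction u rule: less_induct)
  case (less u)
  show ?case
  proof (rule ccontr)
    assume q: "qout A V r u \<noteq> None"
    then obtain p where p: "sched r u = Some p" using qout_None_idle by (metis not_None_eq)
    have leg': "legal A {1..n} V r (Suc u)" using legal_mono[OF leg] less.prems by simp
    have "dec V r (Suc u) p \<noteq> None"
      using query_decides[OF leg' _ p q] less.IH less.prems less_trans by blast
    moreover have "p \<in> {1..n}" using leg less.prems p unfolding legal_def by blast
    ultimately show False using bivalent_undecided[OF biv, of "Suc u" p] less.prems by simp
  qed
qed

text \<open>If every fair step of \<open>p\<close> destroyed bivalence, the value \<open>v\<close>
  reached by stepping \<open>p\<close> at once would be transported along a run deciding the
  opposite value, up to its first decision.\<close>

lemma bivalent_step: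
  assumes leg: "legal A {1..n} V r t" and biv: "bivalent V r t" and p: "p \<in> {1..n}"
  shows "\<exists>r' s. t \<le> s \<and> agree r r' t \<and> legal A {1..n} V r' (Suc s) \<and> bivalent V r' (Suc s) \<and>
    fair_step A V r' s p"
proof (rule ccontr)
  assume "\<not> ?thesis"
  then have no: "\<not> bivalent V r' (Suc s)"
    if "t \<le> s" "agree r r' t" "legal A {1..n} V r' (Suc s)" "fair_step A V r' s p" for r' s
    using that by blast
  have fair_ext: "\<exists>r'. agree \<rho> r' s \<and> fair_step A V r' s p \<and> legal A {1..n} V r' (Suc s)"
    if h: "legal A {1..n} V \<rho> s" "\<And>u. u < s \<Longrightarrow> qout A V \<rho> u = None" for \<rho> s
  proof -
    have "\<not> waiting A V \<rho> s p"
      using h(2) by (intro not_waiting_if_no_query) (simp add: nq_eq_0_iff)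
    then obtain i x where fs: "fair_step A V (upd \<rho> s (Some p) i x) s p"
      using fair_step_exists by blast
    then show ?thesis
      using legal_fair_step[OF legal_agree[OF agree_upd h(1)] fs p] agree_upd by blast
  qed
  obtain e0 where e0: "agree r e0 t" "fair_step A V e0 t p" "legal A {1..n} V e0 (Suc t)"
    using fair_ext[OF leg] bivalent_no_query[OF leg biv] by blast
  obtain v where v: "v \<in> poss V e0 (Suc t)" using poss_nonempty[OF e0(3)] by blast
  obtain F R y s0 where R: "run F V R" "agree r R t" "y \<in> {1..n}" "dec V R s0 y = Some (\<not> v)"
    using biv unfolding bivalent_def poss_def by blast
  define T where "T = (LEAST s. \<exists>x\<in>{1..n}. dec V R s x \<noteq> None)"
  have ex: "\<exists>s. \<exists>x\<in>{1..n}. dec V R s x \<noteq> None" using R(3,4) by force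
  obtain x w where x: "x \<in> {1..n}" "dec V R T x = Some w"
    using LeastI_ex[OF ex] unfolding T_def by blast
  then have xw: "dec V R T x = Some (\<not> v)" using agreement[OF R(1) R(3) x(1) R(4)] by simp
  have before: "dec V R s z = None" if "s < T" "z \<in> {1..n}" for s z
    using not_less_Least that unfolding T_def by blast
  have tT: "t < T"
  proof (rule ccontr)
    assume "\<not> t < T"
    then have "dec V R T x = None"
      using bivalent_undecided[OF biv, of T x] dec_agree[OF R(2), of T V x] x(1) by simp
    then show False using x by simp
  qed
  have free: "qout A V R u = None" if "Suc u < T" for u
  proof (rule no_early_query[OF R(1) _ _ that, of 0])
    show "dec V R (Suc u) z = None" if "0 \<le> u" "Suc u < T" "sched R u = Some z" for u z
      using before[OF that(2)] run_sched[OF R(1) that(3)] by blast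
  qed simp
  have legR: "legal A {1..n} V R T" using run_legal[OF R(1) free] by blast
  \<comment> \<open>Relative to \<open>R\<close> up to \<open>s\<close>, both \<open>e\<close> and
    \<open>r2\<close> add only steps of \<open>p\<close> and of the process \<open>q\<close> that
    \<open>R\<close> schedules at \<open>s\<close>. They share a value, which must be
    \<open>v\<close> because \<open>e\<close> excludes the other one.\<close>
  have neighbour: "v \<in> poss V r2 (Suc (Suc s))"
    if e: "agree R e s" "fair_step A V e s p" "legal A {1..n} V e (Suc s)" "(\<not> v) \<notin> poss V e (Suc s)"
      and s: "Suc s \<le> T"
      and r2: "agree R r2 (Suc s)" "legal A {1..n} V r2 (Suc (Suc s))" "sched r2 (Suc s) \<in> {None, Some p}"
    for e r2 s
  proof -
    obtain q where q: "q \<in> {1..n}" "sched R s \<in> {None, Some q}"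
      using legR s p unfolding legal_def by (metis Suc_le_lessD insertCI not_None_eq)
    have "qout A V R u = None" if "u < s" for u using free that s by simp
    moreover have "legal A {1..n} V R s" using legal_mono[OF legR] s by simp
    ultimately obtain c where c: "\<And>r1. agree R r1 s \<Longrightarrow> legal A {1..n} V r1 (Suc (Suc s)) \<Longrightarrow>
        sched r1 s \<in> {None, Some p, Some q} \<Longrightarrow> sched r1 (Suc s) \<in> {None, Some p, Some q} \<Longrightarrow>
        c \<in> poss V r1 (Suc (Suc s))"
      using common_value[of V R s p q] p q(1) by blast
    \<comment> \<open>An idle slot brings \<open>e\<close> to the length \<open>s + 2\<close> at
      which \<open>common_value\<close> compares successors.\<close>
    define e' where "e' = upd e (Suc s) None NullIn (0, 0)"
    have ee': "agree e e' (Suc s)" by (simp add: e'_def)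
    have "legal A {1..n} V e' (Suc (Suc s))"
      by (rule legal_idle[OF legal_agree[OF ee' e(3)]]) (simp add: e'_def)
    moreover have "agree R e' s" using agree_trans[OF e(1) agree_mono[OF ee']] by simp
    ultimately have "c \<in> poss V e' (Suc (Suc s))"
      by (intro c) (use fair_step_ok(1)[OF e(2)] in \<open>simp_all add: e'_def\<close>)
    then have "c \<in> poss V e (Suc s)" using poss_mono[OF ee'] by (meson le_SucI order_refl subsetD)
    have "c \<noteq> (\<not> v)"
    proof
      assume "c = (\<not> v)"
      with \<open>c \<in> poss V e (Suc s)\<close> e(4) show False by simp
    qed
    then have "c = v" by blast
    moreover have "c \<in> poss V r2 (Suc (Suc s))"
    proof (rule c)
      show "agree R r2 s" using agree_mono[OF r2(1)] by simp
      show "sched r2 s \<in> {None, Some p, Some q}" using agreeD(1)[OF r2(1), of s] q(2) by auto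
    qed (use r2 in auto)
    ultimately show ?thesis by simp
  qed
  have walk: "Suc s \<le> T \<longrightarrow> (\<exists>e. agree R e s \<and> fair_step A V e s p \<and> legal A {1..n} V e (Suc s) \<and>
      (\<not> v) \<notin> poss V e (Suc s))" if "t \<le> s" for s
    using that
  proof (induction s rule: dec_induct)
    case base
    have "agree R e0 t" using agree_trans[OF agree_sym[OF R(2)] e0(1)] .
    moreover have "(\<not> v) \<notin> poss V e0 (Suc t)" using not_bivalent[OF no v] e0 by blast
    ultimately show ?case using e0 by blast
  next
    case (step s)
    show ?case
    proof
      assume s: "Suc (Suc s) \<le> T"
      then obtain e where e: "agree R e s" "fair_step A V e s p" "legal A {1..n} V e (Suc s)"
          "(\<not> v) \<notin> poss V e (Suc s)"
        using step by auto
      have legs: "legal A {1..n} V R (Suc s)" using legal_mono[OF legR] s by simp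
      have "qout A V R u = None" if "u < Suc s" for u using free that s by simp
      then obtain e2 where e2: "agree R e2 (Suc s)" "fair_step A V e2 (Suc s) p"
          "legal A {1..n} V e2 (Suc (Suc s))"
        using fair_ext[OF legs] by blast
      have "v \<in> poss V e2 (Suc (Suc s))"
        by (rule neighbour[OF e]) (use s e2 fair_step_ok(1)[OF e2(2)] in auto)
      moreover have "agree r e2 t"
        using agree_trans[OF R(2) agree_mono[OF e2(1)]] step by simp
      moreover have "t \<le> Suc s" using step by simp
      ultimately have "(\<not> v) \<notin> poss V e2 (Suc (Suc s))" using not_bivalent no e2 by blast
      then show "\<exists>e. agree R e (Suc s) \<and> fair_step A V e (Suc s) p \<and>
          legal A {1..n} V e (Suc (Suc s)) \<and> (\<not> v) \<notin> poss V e (Suc (Suc s))"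
        using e2 by blast
    qed
  qed
  obtain s where s: "T = Suc s" "t \<le> s" using tT by (cases T) auto
  then obtain e where e: "agree R e s" "fair_step A V e s p" "legal A {1..n} V e (Suc s)"
      "(\<not> v) \<notin> poss V e (Suc s)"
    using walk[of s] by auto
  \<comment> \<open>At the end of the walk \<open>p\<close> takes no step after \<open>R\<close>; an
    idle slot replaces it, and \<open>v\<close> remains possible although the opposite value is
    already decided.\<close>
  define r2 where "r2 = upd R T None NullIn (0, 0)"
  have r2: "agree R r2 T" by (simp add: r2_def)
  have "legal A {1..n} V r2 (Suc T)"
    by (rule legal_idle[OF legal_agree[OF r2 legR]]) (simp add: r2_def)
  then have "v \<in> poss V r2 (Suc T)"
    using neighbour[OF e, of r2] r2 s by (simp add: r2_def)
  moreover have "dec V r2 T x = Some (\<not> v)" using xw dec_agree[OF r2, of T V x] by simp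
  ultimately have "v = (\<not> v)" using poss_decided[of V r2 T x "\<not> v" "Suc T" v] x(1) by simp
  then show False by simp
qed

text \<open>Round-robin iteration of \<open>bivalent_step\<close> serves every process infinitely
  often. The limit is a crash-free run all of whose prefixes are bivalent: nobody queries, the
  oracle conditions are vacuous, and nobody decides.\<close>

lemma reduction_False: "False"
proof -
  fix r0 :: "'m schedule"
  obtain V where V: "bivalent V r0 0" using initial_bivalent by blast
  define P where "P = (\<lambda>j r t. legal A {1..n} V r t \<and> bivalent V r t \<and>
      (\<forall>i. j = Suc i \<longrightarrow> (\<exists>s. t = Suc s \<and> fair_step A V r s (Suc (i mod n)))))"
  have init: "P 0 r0 0" using V by (simp add: P_def legal_def)
  have turn: "Suc (i mod n) \<in> {1..n}" for i using f by (simp add: Suc_leI)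
  have step: "\<exists>r' t'. t < t' \<and> agree r r' t \<and> P (Suc j) r' t'" if P: "P j r t" for j r t
  proof -
    have "legal A {1..n} V r t" "bivalent V r t" using P by (auto simp: P_def)
    then obtain r' s where "t \<le> s" "agree r r' t" "legal A {1..n} V r' (Suc s)"
        "bivalent V r' (Suc s)" "fair_step A V r' s (Suc (j mod n))"
      using bivalent_step turn by blast
    then show ?thesis by (intro exI[of _ r'] exI[of _ "Suc s"]) (auto simp: P_def)
  qed
  obtain r T where T: "strict_mono T" "\<And>j. \<exists>r'. P j r' (T j) \<and> agree r' r (T j)"
    using limit_schedule[of P, OF init step] by blast
  have Tj: "legal A {1..n} V r (T j)" "bivalent V r (T j)" for j
  proof -
    obtain r' where r': "P j r' (T j)" "agree r' r (T j)" using T(2) by blast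
    then show "legal A {1..n} V r (T j)" using legal_agree unfolding P_def by blast
    show "bivalent V r (T j)"
      using r' poss_mono[OF agree_sym[OF r'(2)], of "T j" V] unfolding P_def bivalent_def by blast
  qed
  have big: "t \<le> T t" for t using strict_mono_imp_increasing[OF T(1)] .
  have leg: "legal A {1..n} V r t" for t using legal_mono[OF Tj(1) big] .
  have undec: "dec V r t p = None" if "p \<in> {1..n}" for t p
    using bivalent_undecided[OF Tj(2) big that] .
  have noq: "qout A V r t = None" for t
    using bivalent_no_query[OF Tj, of t "Suc t"] big[of "Suc t"] by simp
  have nq: "nq A V r t p = 0" for t p using noq by (simp add: nq_eq_0_iff)
  have fair: "\<exists>s\<ge>t. fair_step A V r s p" if "p \<in> {1..n}" for t p
  proof -
    obtain j where j: "j \<ge> t" "Suc (j mod n) = p" using turn_exists[OF \<open>p \<in> {1..n}\<close>] by blast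
    obtain r' where r': "P (Suc j) r' (T (Suc j))" "agree r' r (T (Suc j))" using T(2) by blast
    then obtain s where s: "T (Suc j) = Suc s" "fair_step A V r' s p"
      using j(2) unfolding P_def by blast
    then have "fair_step A V r s p" using fair_step_agree r'(2) by metis
    moreover have "t \<le> s" using big[of "Suc j"] s(1) j(1) by simp
    ultimately show ?thesis by blast
  qed
  have nw: "\<not> waiting A V r t p" for t p using not_waiting_if_no_query[OF nq] .
  have noresp: "\<not> is_resp (input r t)" if "sched r t = Some p" for t p
    using leg[of "Suc t"] that unfolding legal_def msg_ok_def
    by (metis is_resp_simps(1,2) lessI)
  have corr: "correct {1..n} (\<lambda>_. {}) = {1..n}" by (simp add: correct_def faulty_def)
  have noqe: "\<not> queried_ever A V r k p" for k p using noq by (simp add: queried_ever_def)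
  have "is_run A {1..n} (\<lambda>_. {}) V (cons_problem {1..n}) f r"
    unfolding is_run_iff corr
  proof (intro conjI)
    show "\<forall>t p. sched r t = Some p \<longrightarrow> p \<in> {1..n} \<and> p \<notin> {}"
      using leg unfolding legal_def by blast
    show "\<forall>t p. sched r t = Some p \<longrightarrow>
        (if waiting A V r t p then input r t = RespIn (resp r (nr r t p))
         else input r t = NullIn \<or> msg_ok A V r t p)"
      using leg nw unfolding legal_def by (metis lessI)
    show "\<forall>t t'. sched r t \<noteq> None \<and> sched r t' \<noteq> None \<and> is_msg (input r t) \<and>
        is_msg (input r t') \<and> src r t = src r t' \<longrightarrow> t = t'"
    proof (intro allI impI)
      fix t t'
      assume h: "sched r t \<noteq> None \<and> sched r t' \<noteq> None \<and> is_msg (input r t) \<and>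
        is_msg (input r t') \<and> src r t = src r t'"
      have "t < Suc (max t t')" "t' < Suc (max t t')" by auto
      then show "t = t'" using leg[of "Suc (max t t')"] h unfolding legal_def by blast
    qed
    show "\<forall>t i p m. i < length (sends A V r t) \<and> sends A V r t ! i = (p, m) \<and> p \<in> {1..n} \<longrightarrow>
        (\<exists>t'. sched r t' = Some p \<and> is_msg (input r t') \<and> src r t' = (t, i)) \<or> blocked A V r p"
      using fair_delivery[of A V r, OF fair] by blast
    show "\<forall>p\<in>{1..n}. (\<forall>t. \<exists>t'\<ge>t. sched r t' = Some p) \<or> blocked A V r p"
      using fair fair_step_ok(1) by blast
  qed (use noresp noqe in blast)+
  then have "run (\<lambda>_. {}) V r"
    unfolding run_def by (simp add: failure_pattern_def faulty_def mono_def)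
  moreover have "1 \<in> {1..n}" using f by simp
  ultimately obtain t d where "dec V r t 1 = Some d"
    using terminates[of "\<lambda>_. {}" V r 1] by (auto simp: faulty_def)
  then show False using undec[OF \<open>1 \<in> {1..n}\<close>] by simp
qed

end

theorem mainTheorem14:
  fixes n f :: nat
  assumes "1 \<le> f" and "f \<le> n - 2"
  shows "\<not> (\<exists>A :: ('s, 'm) algorithm.
             solves_with A {1..n} (Cons_task n (f + 1)) (Cons_task n f))"
proof
  assume "\<exists>A :: ('s, 'm) algorithm. solves_with A {1..n} (Cons_task n (f + 1)) (Cons_task n f)"
  then obtain A :: "('s, 'm) algorithm"
    where "solves_with A {1..n} (Cons_task n (f + 1)) (Cons_task n f)" by blast
  \<comment> \<open>The subtraction in \<open>f \<le> n - 2\<close> is truncated, but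
    \<open>1 \<le> f\<close> forces \<open>n \<ge> 3\<close>, hence
    \<open>f + 2 \<le> n\<close>.\<close>
  then have "reduction A n f" using assms by unfold_locales auto
  then show False by (rule reduction.reduction_False)
qed

end
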